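(* Let $K$ be a number field of degree $d$. If $d=1$, or $d=2$, or $K$ is a totally complex quartic number field, then $\mathbf{BA}_K$ is absolute winning (as a subset of $K_S$).
   Context: Number field notation. $K$ is a number field of degree $d$ with ring of integers $\mathcal{O}$; $S$ is the set of Archimedean places of $K$ (one for each real embedding and one for each conjugate pair of complex embeddings). For $v\in S$, $K_v\cong\mathbb{R}$ or $\mathbb{C}$ is the completion with its usual absolute value $|\cdot|$, and $\iota_v:K\to K_v$ is the embedding. $K_S=\prod_{v\in S}K_v\cong\mathbb{R}^d$, with coordinatewise multiplication and norm $\|\mathbf{x}\|=\max_{v\in S}|x_v|$ (which gives the metric), and $\iota_S:K\to K_S$, $r\mapsto(\iota_v(r))_{v\in S}$. An element $\mathbf{x}\in K_S$ is badly approximable if there is $c>0$ such that $\|\iota_S(q)\cdot\mathbf{x}+\iota_S(p)\|>c\,\|\iota_S(q)\|^{-1}$ for all $p\in\mathcal{O}$, $q\in\mathcal{O}\smallsetminus\{0\}$; $\mathbf{BA}_K$ is the set of all such $\mathbf{x}$. The $\mathcal{H}$-absolute game. Let $(X,\mathrm{dist})$ be a complete metric space, $\mathcal{H}$ a non-empty collection of closed subsets of $X$, $Y\subseteq X$ non-empty closed, $0<\beta<1$. A formal ball is a pair $B=(x,\rho)\in X\times\mathbb{R}_{>0}$, with associated closed ball $\mathbf{B}(B)=\{y\in X:\mathrm{dist}(x,y)\le\rho\}$; write $(x_1,\rho_1)\preceq(x_2,\rho_2)$ iff $\mathrm{dist}(x_1,x_2)\le\rho_2-\rho_1$. In the $(\mathcal{H},\beta)$-absolute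 game on $Y$, Bob and Alice alternately choose $B_1,A_1,B_2,A_2,\dots$ such that: Bob chooses $B_n=(c_n,r_n)\in Y\times\mathbb{R}_{>0}$; Alice chooses $A_n=(\mathcal{L}_n,\rho_n)\in\mathcal{H}\times\mathbb{R}_{>0}$ with $0<\rho_n\le\beta r_n$; $\beta r_n\le r_{n+1}\le r_n$ and $B_{n+1}\preceq B_n$; and $\mathrm{dist}(c_{n+1},\mathcal{L}_n)>\rho_n+r_{n+1}$. If at some stage Bob has no legal choice of $B_{n+1}$, the game ends and Bob wins. $W\subseteq X$ is $(\mathcal{H},\beta)$-absolute winning on $Y$ if Alice has a strategy ensuring that Bob always has a legal move and that $W\cap Y\cap\bigcap_{n\ge1}\mathbf{B}(B_n)\ne\varnothing$ regardless of Bob's play. $W$ is $\mathcal{H}$-absolute winning on $Y$ if there is $\beta_0>0$ such that $W$ is $(\mathcal{H},\beta)$-absolute winning on $Y$ for all $0<\beta<\beta_0$; "on $Y$" is omitted when $Y=X$. "Absolute winning" means $\mathcal{H}$-absolute winning for $\mathcal{H}=\{\{x\}:x\in X\}$, the collection of all singletons. Here $X=Y=K_S$. *)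

theory Defs
  imports "HOL-Analysis.Analysis" "HOL-Computational_Algebra.Computational_Algebra"
begin

section \<open>Number fields and their Archimedean places\<close>

class number_field = field_char_0 +
  assumes finite_over_rat:
    "\<exists>B. finite B \<and> (\<forall>x. \<exists>c :: 'a \<Rightarrow> rat. x = (\<Sum>b\<in>B. of_rat (c b) * b))"

definition number_field_degree :: "'k::number_field itself \<Rightarrow> nat" where
  "number_field_degree _ =
     vector_space.dim (\<lambda>(q::rat) (x::'k). of_rat q * x) UNIV"

definition ring_of_integers :: "'k::number_field set" where
  "ring_of_integers = {x. algebraic_int x}"

definition embeddings :: "('k::number_field \<Rightarrow> complex) set" where
  "embeddings = {\<sigma>. \<sigma> 1 = 1 \<and> (\<forall>x y. \<sigma> (x + y) = \<sigma> x + \<sigma> y) \<and> (\<forall>x y. \<sigma> (x * y) = \<sigma> x * \<sigma> y)}"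

definition real_embedding :: "('k::number_field \<Rightarrow> complex) \<Rightarrow> bool" where
  "real_embedding \<sigma> \<longleftrightarrow> range \<sigma> \<subseteq> \<real>"

definition totally_complex :: "'k::number_field itself \<Rightarrow> bool" where
  "totally_complex _ \<longleftrightarrow> (\<forall>\<sigma>\<in>(embeddings :: ('k \<Rightarrow> complex) set). \<not> real_embedding \<sigma>)"

text \<open>A place is a class of embeddings under complex conjugation: a singleton for a real
  embedding, a two-element set for a conjugate pair of complex embeddings.\<close>

type_synonym 'k place = "('k \<Rightarrow> complex) set"

definition arch_places :: "'k::number_field place set" where
  "arch_places = (\<lambda>\<sigma>. {\<sigma>, cnj \<circ> \<sigma>}) ` embeddings"

text \<open>At a complex place this selects one of the two conjugate embeddings, which amounts to
  choosing one of the two identifications of the completion with the complex numbers. The absolute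
  value does not depend on the choice.\<close>

definition place_embedding :: "'k::number_field place \<Rightarrow> 'k \<Rightarrow> complex" where
  "place_embedding v = (SOME \<sigma>. \<sigma> \<in> v)"

definition place_completion :: "'k::number_field place \<Rightarrow> complex set" where
  "place_completion v = (if real_embedding (place_embedding v) then \<real> else UNIV)"


section \<open>The space \<open>K\<^sub>S\<close> and badly approximable elements\<close>

text \<open>Only the coordinates in \<^const>\<open>arch_places\<close> matter; elements are made extensional
  (\<^const>\<open>PiE\<close>) so that equality of functions is equality of tuples.\<close>

definition KS :: "('k::number_field place \<Rightarrow> complex) set" where
  "KS = (\<Pi>\<^sub>E v\<in>arch_places. place_completion v)"

definition KS_norm :: "('k::number_field place \<Rightarrow> complex) \<Rightarrow> real" where
  "KS_norm x = (MAX v\<in>arch_places. cmod (x v))"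

definition KS_dist ::
    "('k::number_field place \<Rightarrow> complex) \<Rightarrow> ('k place \<Rightarrow> complex) \<Rightarrow> real" where
  "KS_dist x y = KS_norm (\<lambda>v\<in>arch_places. x v - y v)"

definition KS_embed :: "'k::number_field \<Rightarrow> ('k place \<Rightarrow> complex)" where
  "KS_embed r = (\<lambda>v\<in>arch_places. place_embedding v r)"

definition badly_approximable :: "('k::number_field place \<Rightarrow> complex) \<Rightarrow> bool" where
  "badly_approximable x \<longleftrightarrow>
     (\<exists>c>0. \<forall>p\<in>ring_of_integers. \<forall>q\<in>ring_of_integers - {0}.
        KS_norm (\<lambda>v\<in>arch_places. KS_embed q v * x v + KS_embed p v)
          > c * inverse (KS_norm (KS_embed q)))"

definition BA :: "('k::number_field place \<Rightarrow> complex) set" where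
  "BA = {x \<in> KS. badly_approximable x}"


section \<open>The \<open>\<H>\<close>-absolute game\<close>

text \<open>The metric space is given by a carrier \<open>X\<close> and a distance function \<open>d\<close> on it. The definitions
  are meant for a complete metric space, a non-empty collection \<open>H\<close> of closed subsets of \<open>X\<close>,
  a non-empty closed set \<open>Y \<subseteq> X\<close>, and \<open>0 < \<beta> < 1\<close>.\<close>

type_synonym 'a formal_ball = "'a \<times> real"
type_synonym 'a alice_move = "'a set \<times> real"

definition assoc_ball :: "'a set \<Rightarrow> ('a \<Rightarrow> 'a \<Rightarrow> real) \<Rightarrow> 'a formal_ball \<Rightarrow> 'a set" where
  "assoc_ball X d = (\<lambda>(x, \<rho>). {y \<in> X. d x y \<le> \<rho>})"

definition formal_le ::
    "('a \<Rightarrow> 'a \<Rightarrow> real) \<Rightarrow> 'a formal_ball \<Rightarrow> 'a formal_ball \<Rightarrow> bool" where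
  "formal_le d = (\<lambda>(x1, \<rho>1) (x2, \<rho>2). d x1 x2 \<le> \<rho>2 - \<rho>1)"

text \<open>Extended-real valued, so that the distance to the empty set is \<open>\<infinity>\<close>.\<close>

definition dist_to_set :: "('a \<Rightarrow> 'a \<Rightarrow> real) \<Rightarrow> 'a \<Rightarrow> 'a set \<Rightarrow> ereal" where
  "dist_to_set d x L = (INF y\<in>L. ereal (d x y))"

definition bob_first :: "'a set \<Rightarrow> 'a formal_ball \<Rightarrow> bool" where
  "bob_first Y = (\<lambda>(c, r). c \<in> Y \<and> r > 0)"

definition alice_legal :: "'a set set \<Rightarrow> real \<Rightarrow> 'a formal_ball \<Rightarrow> 'a alice_move \<Rightarrow> bool" where
  "alice_legal H \<beta> = (\<lambda>(c, r) (L, \<rho>). L \<in> H \<and> 0 < \<rho> \<and> \<rho> \<le> \<beta> * r)"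

definition bob_next ::
    "('a \<Rightarrow> 'a \<Rightarrow> real) \<Rightarrow> 'a set \<Rightarrow> real \<Rightarrow>
      'a formal_ball \<Rightarrow> 'a alice_move \<Rightarrow> 'a formal_ball \<Rightarrow> bool" where
  "bob_next d Y \<beta> = (\<lambda>(c, r) (L, \<rho>) (c', r').
     c' \<in> Y \<and> r' > 0 \<and> \<beta> * r \<le> r' \<and> r' \<le> r \<and> formal_le d (c', r') (c, r) \<and>
     dist_to_set d c' L > ereal (\<rho> + r'))"

text \<open>A strategy for Alice maps the non-empty list \<open>[B\<^sub>1, \<dots>, B\<^sub>n]\<close> of Bob's moves so far to her
  reply \<open>A\<^sub>n\<close>; her earlier moves are determined by it. The list \<open>Bs\<close> below is a sequence of legal
  moves of Bob against the strategy \<open>\<sigma>\<close>.\<close>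

definition legal_history ::
    "('a \<Rightarrow> 'a \<Rightarrow> real) \<Rightarrow> 'a set \<Rightarrow> real \<Rightarrow>
      ('a formal_ball list \<Rightarrow> 'a alice_move) \<Rightarrow> 'a formal_ball list \<Rightarrow> bool" where
  "legal_history d Y \<beta> \<sigma> Bs \<longleftrightarrow>
     Bs \<noteq> [] \<and> bob_first Y (hd Bs) \<and>
     (\<forall>i. Suc i < length Bs \<longrightarrow> bob_next d Y \<beta> (Bs ! i) (\<sigma> (take (Suc i) Bs)) (Bs ! Suc i))"

definition beta_absolute_winning ::
    "'a set \<Rightarrow> ('a \<Rightarrow> 'a \<Rightarrow> real) \<Rightarrow> 'a set set \<Rightarrow> 'a set \<Rightarrow> real \<Rightarrow> 'a set \<Rightarrow> bool" where
  "beta_absolute_winning X d H Y \<beta> W \<longleftrightarrow>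
     (\<exists>\<sigma>.
       (\<forall>Bs. legal_history d Y \<beta> \<sigma> Bs \<longrightarrow>
          alice_legal H \<beta> (last Bs) (\<sigma> Bs) \<and> (\<exists>B'. bob_next d Y \<beta> (last Bs) (\<sigma> Bs) B')) \<and>
       (\<forall>B :: nat \<Rightarrow> 'a formal_ball.
          (\<forall>n. legal_history d Y \<beta> \<sigma> (map B [0..<Suc n])) \<longrightarrow>
          W \<inter> Y \<inter> (\<Inter>n. assoc_ball X d (B n)) \<noteq> {}))"

text \<open>The game is defined for \<open>\<beta> < 1\<close> only, hence the extra bound.\<close>

definition H_absolute_winning ::
    "'a set \<Rightarrow> ('a \<Rightarrow> 'a \<Rightarrow> real) \<Rightarrow> 'a set set \<Rightarrow> 'a set \<Rightarrow> 'a set \<Rightarrow> bool" where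
  "H_absolute_winning X d H Y W \<longleftrightarrow>
     W \<subseteq> X \<and>
     (\<exists>\<beta>0>0. \<forall>\<beta>. 0 < \<beta> \<and> \<beta> < \<beta>0 \<and> \<beta> < 1 \<longrightarrow> beta_absolute_winning X d H Y \<beta> W)"

definition absolute_winning :: "'a set \<Rightarrow> ('a \<Rightarrow> 'a \<Rightarrow> real) \<Rightarrow> 'a set \<Rightarrow> bool" where
  "absolute_winning X d W \<longleftrightarrow> H_absolute_winning X d {{x} |x. x \<in> X} X W"

end

theory Submission
  imports Defs "Jordan_Normal_Form.Char_Poly"
begin

text \<open>Write \<open>s\<close> for the number of places; in all cases \<open>s \<le> 2\<close> and all places have the same local
  degree, so \<open>N(q) = \<Prod>\<^sub>v |q|\<^sub>v \<ge> 1\<close> for nonzero integers \<open>q\<close>. Put \<open>h(q) = N(q)\<close> to the power \<open>2 / s\<close>.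
  Since \<open>s \<le> 2\<close>, \<open>h(q) \<le> |q|\<^sub>v \<parallel>q\<parallel>\<close> for every \<open>v\<close>, so \<open>x\<close> is badly approximable as soon as
  \<open>dist(x, p/q) > c / h(q)\<close> for all \<open>p\<close> and \<open>q\<close>: the elongated neighbourhoods attached to all unit
  multiples of \<open>(p, q)\<close> fit into one ball, and no unit theorem is needed. Applying \<open>N \<ge> 1\<close> to
  \<open>p q' - p' q\<close> shows that distinct fractions satisfy \<open>dist(p/q, p'/q')\<^sup>2 h(q) h(q') \<ge> 1\<close>. Hence near a
  ball of radius \<open>R\<close> at most one fraction has \<open>h(q) \<le> 1 / (8 R)\<close>, and Alice deletes that one.\<close>

section \<open>The absolute game against a separated set of points\<close>

text \<open>The bound \<open>N \<ge> 1\<close> carries the algebraic weight: the product over all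
  embeddings has to be shown rational, and the embeddings have to be counted. Both rest on one fact,
  that every additive map from the field to the complex numbers is a complex combination of
  embeddings. The operators sending a functional \<open>\<phi>\<close> to
  \<open>\<lambda>x. \<phi> (a * x)\<close> commute, and each is diagonalisable because
  \<open>a\<close> is a root of a rational polynomial with simple complex roots. A common
  eigenvector of all of them is a multiple of an embedding. Applied to the coordinate functionals of
  a rational basis, this inverts the matrix of values of the embeddings on that basis, so the
  rational matrix of multiplication by \<open>a\<close> is conjugate to the diagonal matrix of the
  \<open>\<sigma> a\<close>. The count also excludes mixed signatures: a real embedding next to a
  conjugate pair would already make three, which is more than a field of degree at most 2
  has.\<close>

lemma legal_history_last:
  assumes "legal_history d Y \<beta> \<sigma> Bs"
  shows "fst (last Bs) \<in> Y" "0 < snd (last Bs)"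
proof -
  have ne: "Bs \<noteq> []" and first: "bob_first Y (hd Bs)"
    and step: "\<And>i. Suc i < length Bs \<Longrightarrow> bob_next d Y \<beta> (Bs ! i) (\<sigma> (take (Suc i) Bs)) (Bs ! Suc i)"
    using assms by (auto simp: legal_history_def)
  have "fst (last Bs) \<in> Y \<and> 0 < snd (last Bs)"
  proof (cases "length Bs = 1")
    case True
    then have "last Bs = hd Bs" by (cases Bs) auto
    then show ?thesis using first by (auto simp: bob_first_def)
  next
    case False
    then obtain i where i: "length Bs = Suc (Suc i)"
      using ne by (metis One_nat_def Suc_pred length_greater_0_conv nat_neq_iff less_one old.nat.exhaust)
    then have "last Bs = Bs ! Suc i" using ne by (simp add: last_conv_nth)
    then show ?thesis
      using step[of i] i by (auto simp: bob_next_def split: prod.splits)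
  qed
  then show "fst (last Bs) \<in> Y" "0 < snd (last Bs)" by auto
qed

lemma legal_history_play:
  assumes "\<And>n. legal_history d Y \<beta> \<sigma> (map B [0..<Suc n])"
  shows "bob_next d Y \<beta> (B n) (\<sigma> (map B [0..<Suc n])) (B (Suc n))"
proof -
  have "bob_next d Y \<beta> (map B [0..<Suc (Suc n)] ! n) (\<sigma> (take (Suc n) (map B [0..<Suc (Suc n)])))
      (map B [0..<Suc (Suc n)] ! Suc n)"
    using assms[of "Suc n"] unfolding legal_history_def by force
  moreover have "map B [0..<Suc (Suc n)] ! n = B n" "map B [0..<Suc (Suc n)] ! Suc n = B (Suc n)"
    by (simp_all add: nth_append del: upt_Suc)
  moreover have "take (Suc n) (map B [0..<Suc (Suc n)]) = map B [0..<Suc n]"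
    by (simp add: take_map)
  ultimately show ?thesis by (simp only:)
qed

text \<open>The infimum over a singleton is its only value, so the extended-real condition becomes a
  real inequality.\<close>

lemma bob_next_singleton:
  "bob_next d Y \<beta> B ({y}, \<rho>) B' \<longleftrightarrow>
     fst B' \<in> Y \<and> 0 < snd B' \<and> \<beta> * snd B \<le> snd B' \<and> snd B' \<le> snd B \<and>
     d (fst B') (fst B) \<le> snd B - snd B' \<and> \<rho> + snd B' < d (fst B') y"
  by (cases B; cases B') (simp add: bob_next_def formal_le_def dist_to_set_def)

text \<open>\<open>Q\<close> is a relation between points and heights, not a function, because one
  fraction has many representations \<open>p / q\<close> of different heights. Accordingly
  \<open>separated\<close> compares distinct points only. The spheres are there to leave Bob a legal
  move.\<close>

locale separated_points = Metric_space M d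
  for M :: "'a set" and d +
  fixes Q :: "('a \<times> real) set"
  assumes mcomplete: mcomplete
    and unbounded_spheres: "\<And>c t. c \<in> M \<Longrightarrow> 0 < t \<Longrightarrow> \<exists>y\<in>M. d c y = t"
    and points: "\<And>r h. (r, h) \<in> Q \<Longrightarrow> r \<in> M" "\<And>r h. (r, h) \<in> Q \<Longrightarrow> 1 \<le> h"
    and separated: "\<And>r h r' h'. (r, h) \<in> Q \<Longrightarrow> (r', h') \<in> Q \<Longrightarrow> r \<noteq> r' \<Longrightarrow> 1 \<le> (d r r')\<^sup>2 * (h * h')"
begin

text \<open>The final point lies within one radius of the centre, so a point more than two radii
  away is harmless by itself. The constant 1 / 8 is fixed by
  \<open>dangerous_unique\<close>.\<close>

definition dangerous :: "'a formal_ball \<Rightarrow> 'a \<Rightarrow> bool" where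
  "dangerous B r \<longleftrightarrow> (\<exists>h. (r, h) \<in> Q \<and> h * snd B \<le> 1 / 8 \<and> d (fst B) r \<le> 2 * snd B)"

text \<open>A play starts with \<open>B 0\<close>, so odd length means that the last ball has an
  even index. The centre is also the default when nothing is dangerous.\<close>

definition target :: "'a formal_ball list \<Rightarrow> 'a" where
  "target Bs = (if odd (length Bs) \<and> (\<exists>r. dangerous (last Bs) r)
     then SOME r. dangerous (last Bs) r else fst (last Bs))"

text \<open>Alice deletes the dangerous point at every other turn; removing the centre of Bob's ball in
  between forces the radii to tend to zero.\<close>

definition strategy :: "real \<Rightarrow> 'a formal_ball list \<Rightarrow> 'a alice_move" where
  "strategy \<beta> Bs = ({target Bs}, \<beta> * snd (last Bs))"

text \<open>Two dangerous points are at most four radii \<open>R\<close> apart and have heights at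
  most \<open>1 / (8 * R)\<close>. Their squared distance times both heights is at most 16 / 64,
  while separation demands at least 1.\<close>

lemma dangerous_unique:
  assumes "dangerous B r" "dangerous B r'" "fst B \<in> M" "0 < snd B"
  shows "r = r'"
proof (rule ccontr)
  assume neq: "r \<noteq> r'"
  obtain h where h: "(r, h) \<in> Q" "h * snd B \<le> 1 / 8" "d (fst B) r \<le> 2 * snd B"
    using assms(1) unfolding dangerous_def by blast
  obtain h' where h': "(r', h') \<in> Q" "h' * snd B \<le> 1 / 8" "d (fst B) r' \<le> 2 * snd B"
    using assms(2) unfolding dangerous_def by blast
  note pos = points(2)[OF h(1)] points(2)[OF h'(1)]
  have "d r r' \<le> 4 * snd B"
    using triangle[of r "fst B" r'] points(1)[OF h(1)] points(1)[OF h'(1)] assms(3) h(3) h'(3)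
      commute[of r "fst B"] by simp
  then have "(d r r')\<^sup>2 \<le> (4 * snd B)\<^sup>2"
    by (intro power_mono nonneg)
  then have "(d r r')\<^sup>2 * (h * h') \<le> (4 * snd B)\<^sup>2 * (h * h')"
    using pos by (intro mult_right_mono) auto
  also have "\<dots> = 16 * ((h * snd B) * (h' * snd B))"
    by (simp add: power2_eq_square)
  also have "\<dots> \<le> 16 * (1 / 8 * (1 / 8))"
    using h(2) h'(2) pos assms(4) by (intro mult_left_mono mult_mono) auto
  finally show False using separated[OF h(1) h'(1) neq] by simp
qed

lemma target_in:
  assumes "fst (last Bs) \<in> M"
  shows "target Bs \<in> M"
proof -
  have "dangerous (last Bs) r \<Longrightarrow> r \<in> M" for r
    using points(1) unfolding dangerous_def by blast
  then show ?thesis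
    using assms someI_ex[of "dangerous (last Bs)"] by (simp add: target_def)
qed

text \<open>Bob shrinks to radius \<open>\<beta> * R\<close> and must keep his centre more than
  \<open>2 * \<beta> * R\<close> from \<open>y\<close>. The old centre and a point at distance
  \<open>R - \<beta> * R\<close> from it are candidates; they are more than
  \<open>4 * \<beta> * R\<close> apart exactly because \<open>\<beta> < 1 / 5\<close>, so
  \<open>y\<close> cannot block both.\<close>

lemma bob_has_move:
  assumes "fst B \<in> M" "0 < snd B" "y \<in> M" "0 < \<beta>" "\<beta> < 1 / 5"
  shows "\<exists>B'. bob_next d M \<beta> B ({y}, \<beta> * snd B) B'"
proof -
  have pos: "0 < \<beta> * snd B" "5 * (\<beta> * snd B) < snd B" using assms by auto
  have "0 < snd B - \<beta> * snd B" using pos by linarith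
  then obtain c where c: "c \<in> M" "d (fst B) c = snd B - \<beta> * snd B"
    using unbounded_spheres[of "fst B" "snd B - \<beta> * snd B"] assms(1) pos by force
  consider "2 * (\<beta> * snd B) < d (fst B) y" | "2 * (\<beta> * snd B) < d c y"
    using triangle[of "fst B" y c] commute[of c y] assms c pos by fastforce
  then show ?thesis
  proof cases
    case 1
    then show ?thesis
      using assms pos by (intro exI[of _ "(fst B, \<beta> * snd B)"]) (simp add: bob_next_singleton)
  next
    case 2
    then show ?thesis
      using assms pos c by (intro exI[of _ "(c, \<beta> * snd B)"]) (simp add: bob_next_singleton commute)
  qed
qed

lemma strategy_wins:
  assumes \<beta>: "0 < \<beta>" "\<beta> < 1 / 5"
    and play: "\<And>n. legal_history d M \<beta> (strategy \<beta>) (map B [0..<Suc n])"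
  obtains x \<gamma> where "x \<in> M" "\<And>n. x \<in> assoc_ball M d (B n)" "0 < \<gamma>"
    "\<And>r h. (r, h) \<in> Q \<Longrightarrow> \<gamma> / h < d x r"
proof -
  define c R t where "c = (\<lambda>n. fst (B n))" and "R = (\<lambda>n. snd (B n))"
    and "t = (\<lambda>n. target (map B [0..<Suc n]))"
  have last: "last (map B [0..<Suc n]) = B n" for n by simp
  have cM: "c n \<in> M" and Rpos: "0 < R n" for n
    using legal_history_last[OF play[of n]] unfolding last c_def R_def by auto
  have "bob_next d M \<beta> (B n) ({t n}, \<beta> * R n) (B (Suc n))" for n
    using legal_history_play[OF play, of n] unfolding strategy_def last t_def R_def .
  then have R_ge: "\<beta> * R n \<le> R (Suc n)" and R_le: "R (Suc n) \<le> R n"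
    and c_step: "d (c (Suc n)) (c n) \<le> R n - R (Suc n)"
    and t_far: "\<beta> * R n + R (Suc n) < d (c (Suc n)) (t n)" for n
    unfolding bob_next_singleton c_def R_def by blast+
  \<comment> \<open>At an odd index the old centre is deleted. The new centre must be more than the
    new radius away from it, yet nesting allows at most the old radius minus the new one.\<close>
  have halve: "R (Suc (Suc (2 * k))) \<le> R (2 * k) / 2" for k
  proof -
    have "t (Suc (2 * k)) = c (Suc (2 * k))"
      by (simp add: t_def target_def c_def)
    then have "2 * R (Suc (Suc (2 * k))) \<le> R (Suc (2 * k))"
      using t_far[of "Suc (2 * k)"] c_step[of "Suc (2 * k)"] \<beta>(1) Rpos[of "Suc (2 * k)"]
      by (smt (verit) mult_pos_pos)
    then show ?thesis using R_le[of "2 * k"] by simp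
  qed
  have geometric: "R (2 * k) \<le> R 0 * (1 / 2) ^ k" for k
  proof (induction k)
    case (Suc k)
    then show ?case using halve[of k] by simp
  qed simp
  have R_small: "\<exists>k. R (2 * k) < e" if "0 < e" for e
  proof -
    have "(\<lambda>k. R 0 * (1 / 2) ^ k) \<longlonglongrightarrow> R 0 * 0"
      by (intro tendsto_mult_left LIMSEQ_power_zero) simp
    then have "\<forall>\<^sub>F k in sequentially. R 0 * (1 / 2) ^ k < e"
      using that by (intro order_tendstoD(2)) auto
    then show ?thesis using geometric by (meson eventually_happens order_le_less_trans sequentially_bot)
  qed
  have nested: "d (c (n + m)) (c n) \<le> R n - R (n + m)" for n m
  proof (induction m)
    case 0
    then show ?case using cM[of n] by simp
  next
    case (Suc m)
    then show ?case
      using triangle[OF cM[of "Suc (n + m)"] cM[of "n + m"] cM[of n]] c_step[of "n + m"] by simp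
  qed
  have "MCauchy c"
    unfolding MCauchy_def
  proof (intro conjI allI impI)
    show "range c \<subseteq> M" using cM by blast
    fix e :: real assume "0 < e"
    then obtain k where k: "R (2 * k) < e / 2" using R_small[of "e / 2"] by auto
    show "\<exists>N. \<forall>n n'. N \<le> n \<longrightarrow> N \<le> n' \<longrightarrow> d (c n) (c n') < e"
    proof (intro exI allI impI)
      fix n n' assume "2 * k \<le> n" "2 * k \<le> n'"
      then have "d (c n) (c (2 * k)) \<le> R (2 * k)" "d (c n') (c (2 * k)) \<le> R (2 * k)"
        using nested[of "2 * k" "n - 2 * k"] nested[of "2 * k" "n' - 2 * k"] Rpos[of n] Rpos[of n'] by auto
      then show "d (c n) (c n') < e"
        using triangle[OF cM[of n] cM[of "2 * k"] cM[of n']] commute[of "c n'" "c (2 * k)"] k by simp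
    qed
  qed
  then obtain x where "limitin mtopology c x sequentially"
    using mcomplete unfolding mcomplete_def by blast
  then have x: "x \<in> M" and lim: "\<And>e. 0 < e \<Longrightarrow> \<forall>\<^sub>F n in sequentially. c n \<in> M \<and> d (c n) x < e"
    by (auto simp: limitin_metric)
  have x_ball: "d (c n) x \<le> R n" for n
  proof (rule field_le_epsilon)
    fix e :: real assume "0 < e"
    from eventually_happens[OF eventually_conj[OF lim[OF this] eventually_ge_at_top[of n]]]
    obtain m where m: "n \<le> m" "d (c m) x < e" by auto
    then show "d (c n) x \<le> R n + e"
      using triangle[OF cM[of n] cM[of m] x] nested[of n "m - n"] Rpos[of m] commute[of "c n" "c m"] by simp
  qed
  \<comment> \<open>If the height \<open>h\<close> is already below the threshold at stage 0, no
    earlier stage bounds the radius from below, and \<open>\<beta> * R 0\<close> serves since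
    \<open>h \<ge> 1\<close>. Otherwise two stages earlier the radius exceeded
    \<open>1 / (8 * h)\<close>; two turns cost at most a factor \<open>\<beta>\<close> each, and the
    deleted radius costs a third.\<close>
  define \<gamma> where "\<gamma> = min (\<beta> * R 0) (\<beta> ^ 3 / 8)"
  have \<gamma>: "0 < \<gamma>" using \<beta> Rpos[of 0] by (simp add: \<gamma>_def)
  have far: "\<gamma> / h < d x r" if rh: "(r, h) \<in> Q" for r h
  proof -
    have r: "r \<in> M" and h: "1 \<le> h" using points[OF rh] by auto
    have ex: "\<exists>k. h * R (2 * k) \<le> 1 / 8"
      using R_small[of "1 / (8 * h)"] h by (auto simp: field_simps intro: less_imp_le)
    define k where "k = (LEAST k. h * R (2 * k) \<le> 1 / 8)"
    have k: "h * R (2 * k) \<le> 1 / 8"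
      unfolding k_def using ex by (rule LeastI_ex)
    have least: "1 / 8 < h * R (2 * j)" if "j < k" for j
      using that[unfolded k_def] not_less_Least[of j "\<lambda>k. h * R (2 * k) \<le> 1 / 8"] by (simp only: not_le)
    \<comment> \<open>A dangerous \<open>r\<close> is the deleted point, and \<open>x\<close> lies
      in Bob's next ball, which stays farther than \<open>\<beta> * R (2 * k)\<close> from it.
      Otherwise \<open>r\<close> is more than two radii from the centre and \<open>x\<close> at most
      one.\<close>
    have "\<beta> * R (2 * k) < d x r"
    proof (cases "dangerous (B (2 * k)) r")
      case True
      have "t (2 * k) = r"
      proof -
        have "dangerous (B (2 * k)) (SOME r. dangerous (B (2 * k)) r)"
          using True by (rule someI[where P = "dangerous (B (2 * k))"])
        then have "(SOME r. dangerous (B (2 * k)) r) = r"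
          using True cM[of "2 * k", unfolded c_def] Rpos[of "2 * k", unfolded R_def]
          by (rule dangerous_unique)
        moreover have "odd (length (map B [0..<Suc (2 * k)]))" by simp
        ultimately show ?thesis
          using True unfolding t_def target_def last by metis
      qed
      then show ?thesis
        using t_far[of "2 * k"] x_ball[of "Suc (2 * k)"] triangle[OF cM[of "Suc (2 * k)"] x r] by simp
    next
      case False
      then have "2 * R (2 * k) < d (c (2 * k)) r"
        using rh k unfolding dangerous_def c_def R_def by (meson not_le)
      moreover have "\<beta> * R (2 * k) \<le> R (2 * k)"
        using \<beta> Rpos[of "2 * k"] by simp
      ultimately show ?thesis
        using x_ball[of "2 * k"] triangle[OF cM[of "2 * k"] x r] by simp
    qed
    moreover have "\<gamma> / h \<le> \<beta> * R (2 * k)"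
    proof (cases k)
      case 0
      have "\<gamma> / h \<le> \<gamma>" using h \<gamma> by (simp add: divide_le_eq)
      then show ?thesis by (simp add: 0 \<gamma>_def)
    next
      case (Suc j)
      have "\<beta> * (\<beta> * (1 / 8)) \<le> \<beta> * (\<beta> * (h * R (2 * j)))"
        using least[of j] Suc \<beta> by (intro mult_left_mono) auto
      also have "\<dots> = h * (\<beta> * (\<beta> * R (2 * j)))" by simp
      also have "\<dots> \<le> h * (\<beta> * R (Suc (2 * j)))"
        using R_ge[of "2 * j"] h \<beta> by (intro mult_left_mono) auto
      also have "\<dots> \<le> h * R (2 * k)"
        using R_ge[of "Suc (2 * j)"] h Suc by (intro mult_left_mono) auto
      finally have "\<beta> * (\<beta> * (\<beta> * (1 / 8))) \<le> \<beta> * (h * R (2 * k))"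
        using \<beta> by (intro mult_left_mono) auto
      then have "\<gamma> \<le> \<beta> * (h * R (2 * k))"
        by (simp add: \<gamma>_def power3_eq_cube mult.assoc)
      then show ?thesis using h by (simp add: field_simps)
    qed
    ultimately show ?thesis by simp
  qed
  have "x \<in> assoc_ball M d (B n)" for n
    using x x_ball[of n] by (simp add: assoc_ball_def case_prod_unfold c_def R_def)
  then show ?thesis using x far \<gamma> that by blast
qed

lemma absolute_winning_avoiding:
  assumes "W \<subseteq> M"
    and W: "\<And>x \<gamma>. x \<in> M \<Longrightarrow> 0 < \<gamma> \<Longrightarrow> (\<And>r h. (r, h) \<in> Q \<Longrightarrow> \<gamma> / h < d x r) \<Longrightarrow> x \<in> W"
  shows "absolute_winning M d W"
  unfolding absolute_winning_def H_absolute_winning_def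
proof (intro conjI exI[of _ "1 / 5"] allI impI)
  fix \<beta> :: real assume "0 < \<beta> \<and> \<beta> < 1 / 5 \<and> \<beta> < 1"
  then have \<beta>: "0 < \<beta>" "\<beta> < 1 / 5" by auto
  show "beta_absolute_winning M d {{x} |x. x \<in> M} M \<beta> W"
    unfolding beta_absolute_winning_def
  proof (intro exI[of _ "strategy \<beta>"] conjI allI impI)
    fix Bs assume legal: "legal_history d M \<beta> (strategy \<beta>) Bs"
    note last = legal_history_last[OF legal]
    show "alice_legal {{x} |x. x \<in> M} \<beta> (last Bs) (strategy \<beta> Bs)"
      using last \<beta> target_in by (auto simp: alice_legal_def strategy_def case_prod_unfold)
    show "\<exists>B'. bob_next d M \<beta> (last Bs) (strategy \<beta> Bs) B'"
      unfolding strategy_def using last target_in \<beta> by (intro bob_has_move) auto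
  next
    fix B :: "nat \<Rightarrow> 'a formal_ball"
    assume "\<forall>n. legal_history d M \<beta> (strategy \<beta>) (map B [0..<Suc n])"
    then obtain x \<gamma> where "x \<in> M" "\<And>n. x \<in> assoc_ball M d (B n)" "0 < \<gamma>"
      "\<And>r h. (r, h) \<in> Q \<Longrightarrow> \<gamma> / h < d x r"
      using strategy_wins[OF \<beta>] by blast
    then show "W \<inter> M \<inter> (\<Inter>n. assoc_ball M d (B n)) \<noteq> {}"
      using W by blast
  qed
qed (use assms in auto)

end


section \<open>Algebraic integers\<close>

text \<open>The determinant trick: \<open>x\<close> is an eigenvalue of the integer matrix of
  multiplication by \<open>x\<close> on the generators \<open>b\<close>, hence a root of its monic
  characteristic polynomial. The condition on \<open>i0\<close> makes the eigenvector
  nonzero.\<close>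

lemma algebraic_int_if_mult_stable:
  fixes x :: "'a::field_char_0" and b :: "'i \<Rightarrow> 'a"
  assumes fin: "finite I" and i0: "i0 \<in> I" "b i0 \<noteq> 0"
    and stable: "\<And>i. i \<in> I \<Longrightarrow> \<exists>c. x * b i = (\<Sum>j\<in>I. of_int (c j) * b j)"
  shows "algebraic_int x"
proof -
  obtain f where f: "bij_betw f {0..<card I} I"
    using ex_bij_betw_nat_finite[OF fin] by blast
  define n where "n = card I"
  obtain A where A: "\<And>i. i \<in> I \<Longrightarrow> x * b i = (\<Sum>j\<in>I. of_int (A i j) * b j)"
    using stable by metis
  define M where "M = mat n n (\<lambda>(i, j). A (f i) (f j))"
  define v where "v = vec n (\<lambda>i. b (f i))"
  have M: "M \<in> carrier_mat n n" and v: "v \<in> carrier_vec n"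
    by (simp_all add: M_def v_def)
  let ?h = "of_int :: int \<Rightarrow> 'a"
  have fI: "f i \<in> I" if "i < n" for i
    using f that by (auto simp: bij_betw_def n_def)
  have "map_mat ?h M *\<^sub>v v = x \<cdot>\<^sub>v v"
  proof (rule eq_vecI)
    fix i assume "i < dim_vec (x \<cdot>\<^sub>v v)"
    then have i: "i < n" by (simp add: v_def)
    have "(map_mat ?h M *\<^sub>v v) $ i = (\<Sum>j\<in>{0..<n}. of_int (A (f i) (f j)) * b (f j))"
      using i by (simp add: M_def v_def scalar_prod_def)
    also have "\<dots> = (\<Sum>j\<in>I. of_int (A (f i) j) * b j)"
      using sum.reindex_bij_betw[OF f] by (simp add: n_def)
    also have "\<dots> = (x \<cdot>\<^sub>v v) $ i"
      using A[OF fI[OF i]] i by (simp add: v_def)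
    finally show "(map_mat ?h M *\<^sub>v v) $ i = (x \<cdot>\<^sub>v v) $ i" .
  qed (simp add: M_def v_def)
  moreover have "v \<noteq> 0\<^sub>v n"
  proof -
    obtain k where k: "k < n" "f k = i0"
      using f i0(1) by (force simp: bij_betw_def n_def image_iff)
    then have "v $ k \<noteq> 0" using i0(2) by (simp add: v_def)
    then show ?thesis using k by auto
  qed
  ultimately have "eigenvalue (map_mat ?h M) x"
    using v M unfolding eigenvalue_def eigenvector_def by auto
  then have "poly (char_poly (map_mat ?h M)) x = 0"
    using eigenvalue_root_char_poly[of "map_mat ?h M" n x] M by auto
  moreover have "char_poly (map_mat ?h M) = map_poly ?h (char_poly M)"
    by (rule of_int_hom.char_poly_hom[OF M])
  moreover have "lead_coeff (char_poly M) = 1"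
    using degree_monic_char_poly[OF M] by auto
  ultimately show ?thesis
    unfolding algebraic_int_altdef_ipoly by metis
qed

lemma algebraic_int_power_relation:
  fixes x :: "'a::field_char_0"
  assumes "algebraic_int x"
  obtains n c where "n > 0" "x ^ n = (\<Sum>k<n. of_int (c k) * x ^ k)"
proof -
  obtain p where p: "poly (map_poly of_int p) x = 0" "lead_coeff p = 1"
    using assms unfolding algebraic_int_altdef_ipoly by blast
  let ?n = "degree p"
  have "degree (map_poly of_int p :: 'a poly) = ?n"
    by (simp add: degree_map_poly)
  then have "0 = (\<Sum>k\<le>?n. of_int (coeff p k) * x ^ k)"
    using p(1) by (simp add: poly_altdef coeff_map_poly)
  also have "\<dots> = (\<Sum>k<?n. of_int (coeff p k) * x ^ k) + x ^ ?n"
    using p(2) by (simp add: lessThan_Suc_atMost[symmetric])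
  finally have rel: "x ^ ?n = (\<Sum>k<?n. of_int (- coeff p k) * x ^ k)"
    by (simp add: sum_negf eq_neg_iff_add_eq_0 add.commute)
  have "?n > 0"
  proof (rule ccontr)
    assume "\<not> ?n > 0"
    then show False using rel by simp
  qed
  then show ?thesis using rel by (rule that)
qed

text \<open>The monomials \<open>x ^ i * y ^ j\<close> below the degrees of two monic relations
  generate a module stable under both factors. Sum and product of \<open>x\<close> and
  \<open>y\<close> stabilise the same module, which yields closure under both operations.\<close>

lemma algebraic_int_common_module:
  fixes x y :: "'a::field_char_0"
  assumes "algebraic_int x" "algebraic_int y"
  obtains b :: "nat \<times> nat \<Rightarrow> 'a" and I i0 where
    "finite I" "i0 \<in> I" "b i0 \<noteq> 0"
    "\<And>i. i \<in> I \<Longrightarrow> \<exists>c. x * b i = (\<Sum>j\<in>I. of_int (c j) * b j)"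
    "\<And>i. i \<in> I \<Longrightarrow> \<exists>c. y * b i = (\<Sum>j\<in>I. of_int (c j) * b j)"
proof -
  obtain n c where n: "n > 0" "x ^ n = (\<Sum>k<n. of_int (c k) * x ^ k)"
    using algebraic_int_power_relation[OF assms(1)] by blast
  obtain m e where m: "m > 0" "y ^ m = (\<Sum>k<m. of_int (e k) * y ^ k)"
    using algebraic_int_power_relation[OF assms(2)] by blast
  define I where "I = {..<n} \<times> {..<m}"
  define b where "b = (\<lambda>(i, j). x ^ i * y ^ j)"
  have finI: "finite I" by (simp add: I_def)
  have single: "\<exists>c. b i = (\<Sum>j\<in>I. of_int (c j) * b j)" if "i \<in> I" for i
    using that finI
    by (intro exI[of _ "\<lambda>j. if j = i then 1 else 0"]) (simp add: if_distrib if_distribR sum.delta cong: if_cong)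
  have 1: "\<exists>c. x * b i = (\<Sum>j\<in>I. of_int (c j) * b j)" if i: "i \<in> I" for i
  proof -
    obtain k l where i: "i = (k, l)" "k < n" "l < m" using i by (auto simp: I_def)
    show ?thesis
    proof (cases "Suc k < n")
      case True
      then show ?thesis using single[of "(Suc k, l)"] i by (simp add: I_def b_def mult_ac)
    next
      case False
      then have "Suc k = n" using i by simp
      then have "x * b i = (\<Sum>k<n. of_int (c k) * x ^ k) * y ^ l"
        using n(2) i by (simp add: b_def mult_ac flip: power_Suc)
      also have "\<dots> = (\<Sum>k<n. \<Sum>j<m. of_int (if j = l then c k else 0) * (x ^ k * y ^ j))"
        using i by (simp add: sum_distrib_left sum_distrib_right if_distrib if_distribR sum.delta mult_ac cong: if_cong)
      also have "\<dots> = (\<Sum>j\<in>I. of_int (if snd j = l then c (fst j) else 0) * b j)"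
        by (simp add: I_def b_def sum.cartesian_product case_prod_unfold)
      finally show ?thesis by (rule exI[of _ "\<lambda>j. if snd j = l then c (fst j) else 0"])
    qed
  qed
  have 2: "\<exists>c. y * b i = (\<Sum>j\<in>I. of_int (c j) * b j)" if i: "i \<in> I" for i
  proof -
    obtain k l where i: "i = (k, l)" "k < n" "l < m" using i by (auto simp: I_def)
    show ?thesis
    proof (cases "Suc l < m")
      case True
      then show ?thesis using single[of "(k, Suc l)"] i by (simp add: I_def b_def mult_ac)
    next
      case False
      then have "Suc l = m" using i by simp
      then have "y * b i = x ^ k * (\<Sum>l<m. of_int (e l) * y ^ l)"
        using m(2) i by (simp add: b_def mult_ac flip: power_Suc)
      also have "\<dots> = (\<Sum>j<m. \<Sum>k'<n. of_int (if k' = k then e j else 0) * (x ^ k' * y ^ j))"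
        using i by (simp add: sum_distrib_left if_distrib if_distribR sum.delta mult_ac cong: if_cong)
      also have "\<dots> = (\<Sum>j\<in>I. of_int (if fst j = k then e (snd j) else 0) * b j)"
        by (subst sum.swap) (simp add: I_def b_def sum.cartesian_product case_prod_unfold)
      finally show ?thesis by (rule exI[of _ "\<lambda>j. if fst j = k then e (snd j) else 0"])
    qed
  qed
  show ?thesis
    by (rule that[of I "(0, 0)" b]) (use finI 1 2 n m in \<open>auto simp: I_def b_def\<close>)
qed

lemma algebraic_int_plus:
  fixes x y :: "'a::field_char_0"
  assumes "algebraic_int x" "algebraic_int y"
  shows "algebraic_int (x + y)"
  using assms
proof (rule algebraic_int_common_module)
  fix b :: "nat \<times> nat \<Rightarrow> 'a" and I i0
  assume fin: "finite I" "i0 \<in> I" "b i0 \<noteq> 0"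
    and 1: "\<And>i. i \<in> I \<Longrightarrow> \<exists>c. x * b i = (\<Sum>j\<in>I. of_int (c j) * b j)"
    and 2: "\<And>i. i \<in> I \<Longrightarrow> \<exists>c. y * b i = (\<Sum>j\<in>I. of_int (c j) * b j)"
  show ?thesis
  proof (rule algebraic_int_if_mult_stable[where b = b, OF fin])
    fix i assume i: "i \<in> I"
    obtain c e where "x * b i = (\<Sum>j\<in>I. of_int (c j) * b j)" "y * b i = (\<Sum>j\<in>I. of_int (e j) * b j)"
      using 1[OF i] 2[OF i] by blast
    then have "(x + y) * b i = (\<Sum>j\<in>I. of_int (c j + e j) * b j)"
      by (simp add: ring_distribs sum.distrib)
    then show "\<exists>c. (x + y) * b i = (\<Sum>j\<in>I. of_int (c j) * b j)"
      by (rule exI[of _ "\<lambda>j. c j + e j"])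
  qed
qed

lemma algebraic_int_times:
  fixes x y :: "'a::field_char_0"
  assumes "algebraic_int x" "algebraic_int y"
  shows "algebraic_int (x * y)"
  using assms
proof (rule algebraic_int_common_module)
  fix b :: "nat \<times> nat \<Rightarrow> 'a" and I i0
  assume fin: "finite I" "i0 \<in> I" "b i0 \<noteq> 0"
    and 1: "\<And>i. i \<in> I \<Longrightarrow> \<exists>c. x * b i = (\<Sum>j\<in>I. of_int (c j) * b j)"
    and 2: "\<And>i. i \<in> I \<Longrightarrow> \<exists>c. y * b i = (\<Sum>j\<in>I. of_int (c j) * b j)"
  obtain c where c: "\<And>i. i \<in> I \<Longrightarrow> x * b i = (\<Sum>j\<in>I. of_int (c i j) * b j)"
    using 1 by metis
  show ?thesis
  proof (rule algebraic_int_if_mult_stable[where b = b, OF fin])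
    fix i assume i: "i \<in> I"
    obtain e where "y * b i = (\<Sum>j\<in>I. of_int (e j) * b j)"
      using 2[OF i] by blast
    then have "(x * y) * b i = (\<Sum>j\<in>I. of_int (e j) * (x * b j))"
      by (simp add: mult.assoc sum_distrib_left mult.left_commute)
    also have "\<dots> = (\<Sum>j\<in>I. \<Sum>k\<in>I. of_int (e j * c j k) * b k)"
      by (simp add: c sum_distrib_left mult.assoc)
    also have "\<dots> = (\<Sum>k\<in>I. of_int (\<Sum>j\<in>I. e j * c j k) * b k)"
      by (subst sum.swap) (simp add: sum_distrib_right)
    finally show "\<exists>c. (x * y) * b i = (\<Sum>j\<in>I. of_int (c j) * b j)"
      by (rule exI[of _ "\<lambda>k. \<Sum>j\<in>I. e j * c j k"])
  qed
qed

lemma algebraic_int_prod: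
  fixes f :: "'i \<Rightarrow> 'a::field_char_0"
  assumes "\<And>i. i \<in> I \<Longrightarrow> algebraic_int (f i)"
  shows "algebraic_int (prod f I)"
  using assms
  by (induction I rule: infinite_finite_induct) (auto intro: algebraic_int_times int_imp_algebraic_int)

lemma algebraic_int_diff:
  fixes x y :: "'a::field_char_0"
  assumes "algebraic_int x" "algebraic_int y"
  shows "algebraic_int (x - y)"
  using algebraic_int_plus[OF assms(1) algebraic_int_minus[OF assms(2)]] by simp


section \<open>Embeddings of a number field\<close>

interpretation rat_space: vector_space "\<lambda>(q::rat) (x::'a::field_char_0). of_rat q * x"
  by standard (simp_all add: algebra_simps of_rat_add of_rat_mult)

lemma number_field_basis:
  obtains B :: "'k::number_field set" where
    "finite B" "rat_space.independent B" "rat_space.span B = UNIV"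
    "card B = number_field_degree TYPE('k)"
proof -
  obtain B where B: "rat_space.independent (B :: 'k set)" "UNIV \<subseteq> rat_space.span B"
    "card B = number_field_degree TYPE('k)"
    using rat_space.basis_exists[of UNIV] unfolding number_field_degree_def by metis
  obtain C :: "'k set" where C: "finite C" "\<And>x. \<exists>c. x = (\<Sum>b\<in>C. of_rat (c b) * b)"
    using finite_over_rat by blast
  have "x \<in> rat_space.span C" for x
  proof -
    obtain c where "x = (\<Sum>b\<in>C. of_rat (c b) * b)" using C(2) by blast
    moreover have "\<dots> \<in> rat_space.span C"
      by (intro rat_space.span_sum rat_space.span_scale rat_space.span_base)
    ultimately show ?thesis by simp
  qed
  then have "finite B"
    using rat_space.independent_span_bound[OF C(1) B(1)] by blast
  with B show ?thesis by (intro that[of B]) auto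
qed

text \<open>Additive maps between rational vector spaces are automatically linear, so additivity
  alone serves as the notion of linearity below.\<close>

lemma additive_of_rat:
  fixes \<phi> :: "'a::field_char_0 \<Rightarrow> 'b::field_char_0"
  assumes "Modules.additive \<phi>"
  shows "\<phi> (of_rat q * x) = of_rat q * \<phi> x"
proof -
  interpret Modules.additive \<phi> by fact
  have nat: "\<phi> (of_nat n * x) = of_nat n * \<phi> x" for n x
    by (induction n) (simp_all add: zero add ring_distribs)
  have int: "\<phi> (of_int n * x) = of_int n * \<phi> x" for n x
    by (cases n rule: int_cases2) (simp_all add: nat minus)
  obtain a b where q: "q = of_int a / of_int b" "b \<noteq> 0"
    by (metis Fract_of_int_quotient Rat_cases less_irrefl)
  have rat: "of_rat q = (of_int a / of_int b :: 'a)" "of_rat q = (of_int a / of_int b :: 'b)"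
    using q(1) by (simp_all add: of_rat_divide)
  have "of_int b * \<phi> (of_rat q * x) = \<phi> (of_int b * (of_rat q * x))"
    by (simp add: int)
  also have "of_int b * (of_rat q * x) = of_int a * x"
    using q(2) by (simp add: rat)
  also have "\<phi> \<dots> = of_int a * \<phi> x"
    by (simp add: int)
  finally have "\<phi> (of_rat q * x) = of_int a / of_int b * \<phi> x"
    using q(2) by (simp add: field_simps)
  then show ?thesis by (simp add: rat)
qed

section \<open>Annihilating polynomials with simple roots\<close>

lemma number_field_algebraic:
  fixes a :: "'k::number_field"
  obtains p :: "rat poly" where "p \<noteq> 0" "poly (map_poly of_rat p) a = 0"
proof -
  interpret ck: map_poly_inj_idom_hom "of_rat :: rat \<Rightarrow> 'k" ..
  obtain B :: "'k set" where B: "finite B" "rat_space.independent B" "rat_space.span B = UNIV"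
    using number_field_basis by metis
  define S where "S = (\<lambda>i. a ^ i) ` {..card B}"
  \<comment> \<open>Dependence is a property of sets, which forget repetitions. Distinct powers
    outnumber a basis and are dependent; coinciding powers give a difference of two
    monomials.\<close>
  show ?thesis
  proof (cases "inj_on (\<lambda>i. a ^ i) {..card B}")
    case True
    then have "card S = Suc (card B)"
      by (simp add: S_def card_image)
    then have "rat_space.dependent S"
      using rat_space.independent_span_bound[OF B(1), of S] B(3) by force
    moreover have "finite S" by (simp add: S_def)
    ultimately obtain u where u: "\<exists>v\<in>S. u v \<noteq> 0" "(\<Sum>v\<in>S. of_rat (u v) * v) = 0"
      using rat_space.dependent_finite[of S] by blast
    define p where "p = (\<Sum>i\<le>card B. monom (u (a ^ i)) i)"
    have coeff: "coeff p i = (if i \<le> card B then u (a ^ i) else 0)" for i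
      by (simp add: p_def coeff_sum)
    have "p \<noteq> 0"
    proof
      assume "p = 0"
      then have "u v = 0" if "v \<in> S" for v
        using that coeff by (auto simp: S_def) (metis coeff_0)
      then show False using u(1) by blast
    qed
    moreover have "poly (map_poly of_rat p) a = (\<Sum>i\<le>card B. of_rat (u (a ^ i)) * a ^ i)"
      unfolding p_def by (simp add: ck.hom_sum poly_sum poly_monom)
    moreover have "\<dots> = (\<Sum>v\<in>S. of_rat (u v) * v)"
      unfolding S_def by (subst sum.reindex[OF True]) simp
    ultimately show ?thesis using u(2) that by simp
  next
    case False
    then obtain i j where ij: "i < j" "a ^ i = a ^ j"
      unfolding inj_on_def by (metis nat_neq_iff)
    define p :: "rat poly" where "p = monom 1 j - monom 1 i"
    have "coeff p j = 1" using ij by (simp add: p_def)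
    then have "p \<noteq> 0" by auto
    moreover have "poly (map_poly of_rat p) a = 0"
      unfolding p_def using ij by (simp add: of_rat_hom.map_poly_hom_monom hom_distribs poly_monom)
    ultimately show ?thesis by (rule that)
  qed
qed

text \<open>A nonzero annihilating polynomial of least degree is coprime to its derivative.\<close>

lemma separable_annihilator:
  fixes a :: "'k::number_field"
  obtains p :: "rat poly" where "poly (map_poly of_rat p) a = 0"
    "rsquarefree (map_poly of_rat p :: complex poly)"
proof -
  define ann where "ann = (\<lambda>p::rat poly. p \<noteq> 0 \<and> poly (map_poly of_rat p) a = 0)"
  interpret ck: map_poly_inj_idom_hom "of_rat :: rat \<Rightarrow> 'k" ..
  interpret cc: map_poly_inj_idom_hom "of_rat :: rat \<Rightarrow> complex" ..
  have "\<exists>p. ann p"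
    using number_field_algebraic[of a] unfolding ann_def by metis
  then obtain p where p: "ann p" and least: "\<And>q. ann q \<Longrightarrow> degree p \<le> degree q"
    using ex_has_least_nat[of ann _ degree] by blast
  have deg: "degree p > 0"
  proof (rule ccontr)
    assume "\<not> degree p > 0"
    then obtain c where "p = [:c:]" using degree_eq_zeroE by blast
    then show False using p by (simp add: ann_def hom_distribs)
  qed
  \<comment> \<open>The ideal generated by \<open>p\<close> and its derivative. An element of least
    degree divides all others, so it is the greatest common divisor and comes with its Bezout
    identity.\<close>
  define I where "I = {u * p + v * pderiv p | u v. True}"
  have I_mod: "q mod g \<in> I" if q: "q \<in> I" and g: "g \<in> I" for q g
  proof -
    obtain u v u' v' where "q = u * p + v * pderiv p" "g = u' * p + v' * pderiv p"
      using q g unfolding I_def by blast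
    then have "q mod g = (u - q div g * u') * p + (v - q div g * v') * pderiv p"
      unfolding minus_div_mult_eq_mod[symmetric, of q g] by (simp only: ring_distribs mult.assoc)
    then show ?thesis unfolding I_def by blast
  qed
  have "p = 1 * p + 0 * pderiv p" "pderiv p = 0 * p + 1 * pderiv p" by simp_all
  then have pI: "p \<in> I" "pderiv p \<in> I" unfolding I_def by blast+
  have "\<exists>g. g \<in> I \<and> g \<noteq> 0" using pI p by (auto simp: ann_def)
  then obtain g where g: "g \<in> I" "g \<noteq> 0" and g_least: "\<And>q. q \<in> I \<Longrightarrow> q \<noteq> 0 \<Longrightarrow> degree g \<le> degree q"
    using ex_has_least_nat[of "\<lambda>g. g \<in> I \<and> g \<noteq> 0" _ degree] by blast
  have dvd: "g dvd q" if "q \<in> I" for q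
  proof (rule ccontr)
    assume "\<not> g dvd q"
    then have "q mod g \<noteq> 0" by (simp add: dvd_eq_mod_eq_0)
    then show False
      using g_least[OF I_mod[OF that g(1)]] degree_mod_less[OF g(2), of q] by simp
  qed
  obtain h where h: "p = g * h" using dvd[OF pI(1)] by blast
  have nz: "g \<noteq> 0" "h \<noteq> 0" using h p by (auto simp: ann_def)
  have "pderiv p \<noteq> 0" using deg by (simp add: pderiv_eq_0_iff)
  then have "degree g \<le> degree (pderiv p)"
    using dvd[OF pI(2)] by (rule dvd_imp_degree_le[rotated])
  then have "degree g < degree p" using deg by (simp add: degree_pderiv)
  \<comment> \<open>The degree of \<open>g\<close> is too small for annihilating \<open>a\<close>,
    so the cofactor \<open>h\<close> does. Minimality of \<open>degree p\<close> leaves degree 0 for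
    \<open>g\<close>, and the Bezout identity with a nonzero constant excludes common complex
    roots.\<close>
  then have "\<not> ann g" using least by fastforce
  moreover have "poly (map_poly of_rat g) a * poly (map_poly of_rat h) a = 0"
    using p h by (simp add: ann_def ck.hom_mult)
  ultimately have "ann h" using nz by (auto simp: ann_def)
  then have "degree g + degree h \<le> degree h"
    using least h nz by (metis degree_mult_eq)
  then have "degree g = 0" by simp
  then obtain c where c: "g = [:c:]" "c \<noteq> 0"
    using nz by (metis degree_eq_zeroE pCons_0_0)
  obtain u v where uv: "u * p + v * pderiv p = [:c:]"
    using g(1) c unfolding I_def by blast
  have "map_poly of_rat (u * p + v * pderiv p) = (map_poly of_rat [:c:] :: complex poly)"
    by (simp only: uv)
  then have "map_poly of_rat u * map_poly of_rat p + map_poly of_rat v * pderiv (map_poly of_rat p)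
      = [:of_rat c :: complex:]"
    by (simp only: cc.hom_add cc.hom_mult of_rat_hom.map_poly_pderiv of_rat_hom.map_poly_pCons_hom
        cc.hom_zero)
  from arg_cong[OF this, of "\<lambda>q. poly q z" for z]
  have bezout: "poly (map_poly of_rat u) z * poly (map_poly of_rat p) z +
      poly (map_poly of_rat v) z * poly (pderiv (map_poly of_rat p)) z = of_rat c" for z :: complex
    by simp
  have "\<not> (poly (map_poly of_rat p) z = 0 \<and> poly (pderiv (map_poly of_rat p)) z = 0)" for z :: complex
  proof
    assume "poly (map_poly of_rat p) z = 0 \<and> poly (pderiv (map_poly of_rat p)) z = 0"
    then show False using bezout[of z] c(2) by simp
  qed
  then have "rsquarefree (map_poly of_rat p :: complex poly)"
    unfolding rsquarefree_roots by blast
  then show ?thesis using p that unfolding ann_def by blast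
qed

section \<open>Simultaneous diagonalisation of multiplication on functionals\<close>

text \<open>The value at \<open>x\<close> of \<open>p(T) \<phi>\<close>, where the operator
  \<open>T\<close> precomposes functionals with multiplication by \<open>a\<close>.\<close>

definition poly_act :: "'a::field_char_0 \<Rightarrow> ('a \<Rightarrow> complex) \<Rightarrow> complex poly \<Rightarrow> 'a \<Rightarrow> complex" where
  "poly_act a \<phi> p x = (\<Sum>i\<le>degree p. coeff p i * \<phi> (a ^ i * x))"

lemma poly_act_ge:
  assumes "degree p \<le> n"
  shows "poly_act a \<phi> p x = (\<Sum>i\<le>n. coeff p i * \<phi> (a ^ i * x))"
  unfolding poly_act_def using assms
  by (intro sum.mono_neutral_left) (auto simp: coeff_eq_0)

lemma poly_act_smult: "poly_act a \<phi> (Polynomial.smult c p) x = c * poly_act a \<phi> p x"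
  by (subst (1 2) poly_act_ge[of _ "degree p"]) (simp_all add: sum_distrib_left mult.assoc)

lemma poly_act_linear_factor:
  "poly_act a \<phi> ([:- w, 1:] * q) x = poly_act a (\<lambda>x. \<phi> (a * x) - w * \<phi> x) q x"
proof -
  let ?n = "degree q"
  have eq: "[:- w, 1:] * q = pCons 0 q - Polynomial.smult w q"
    by simp
  have deg: "degree ([:- w, 1:] * q) \<le> Suc ?n"
    using degree_mult_le[of "[:- w, 1:]" q] by simp
  have "(\<Sum>i\<le>Suc ?n. coeff q i * \<phi> (a ^ i * x)) = (\<Sum>i\<le>?n. coeff q i * \<phi> (a ^ i * x))"
    by (simp add: coeff_eq_0)
  moreover have "(\<Sum>i\<le>Suc ?n. coeff (pCons 0 q) i * \<phi> (a ^ i * x))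
      = (\<Sum>i\<le>?n. coeff q i * \<phi> (a * (a ^ i * x)))"
    by (subst sum.atMost_Suc_shift) (simp add: mult.assoc)
  moreover have "poly_act a \<phi> ([:- w, 1:] * q) x =
      (\<Sum>i\<le>Suc ?n. coeff (pCons 0 q) i * \<phi> (a ^ i * x)) - w * (\<Sum>i\<le>Suc ?n. coeff q i * \<phi> (a ^ i * x))"
    unfolding poly_act_ge[OF deg] unfolding eq
    by (simp only: coeff_diff coeff_smult left_diff_distrib sum_subtractf mult.assoc sum_distrib_left)
  moreover have "poly_act a (\<lambda>x. \<phi> (a * x) - w * \<phi> x) q x =
      (\<Sum>i\<le>?n. coeff q i * \<phi> (a * (a ^ i * x))) - w * (\<Sum>i\<le>?n. coeff q i * \<phi> (a ^ i * x))"
    by (simp add: poly_act_def right_diff_distrib sum_subtractf sum_distrib_left mult.left_commute)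
  ultimately show ?thesis by metis
qed

text \<open>By rational linearity the value is \<open>\<phi>\<close> at \<open>p(a) * x\<close>, so
  every relation of \<open>a\<close> passes to the operator.\<close>

lemma poly_act_annihilator:
  fixes a :: "'a::field_char_0"
  assumes "Modules.additive \<phi>" "poly (map_poly of_rat p) a = 0"
  shows "poly_act a \<phi> (map_poly of_rat p) x = 0"
proof -
  interpret Modules.additive \<phi> by fact
  have "poly_act a \<phi> (map_poly of_rat p) x = \<phi> (\<Sum>i\<le>degree p. of_rat (coeff p i) * (a ^ i * x))"
    by (simp add: poly_act_def sum additive_of_rat[OF assms(1)])
  also have "(\<Sum>i\<le>degree p. of_rat (coeff p i) * (a ^ i * x)) = poly (map_poly of_rat p) a * x"
    by (simp add: poly_altdef sum_distrib_right mult.assoc)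
  finally show ?thesis using assms(2) zero by simp
qed

text \<open>A complex subspace of additive functionals, stable under all multiplication operators.
  As a predicate it can be cut down to an eigenspace by a conjunction.\<close>

definition invariant_family :: "(('a::field_char_0 \<Rightarrow> complex) \<Rightarrow> bool) \<Rightarrow> bool" where
  "invariant_family U \<longleftrightarrow>
     (\<forall>\<phi>. U \<phi> \<longrightarrow> Modules.additive \<phi>) \<and>
     (\<forall>\<phi> \<psi> c. U \<phi> \<longrightarrow> U \<psi> \<longrightarrow> U (\<lambda>x. \<phi> x + c * \<psi> x)) \<and>
     (\<forall>\<phi> a. U \<phi> \<longrightarrow> U (\<lambda>x. \<phi> (a * x)))"

lemma invariant_family_add_scaled:
  "invariant_family U \<Longrightarrow> U \<phi> \<Longrightarrow> U \<psi> \<Longrightarrow> U (\<lambda>x. \<phi> x + c * \<psi> x)"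
  by (simp add: invariant_family_def)

lemma invariant_family_mult:
  "invariant_family U \<Longrightarrow> U \<phi> \<Longrightarrow> U (\<lambda>x. \<phi> (a * x))"
  by (simp add: invariant_family_def)

lemma invariant_family_combination:
  assumes "invariant_family U" "U \<phi>" "\<And>z. z \<in> Z \<Longrightarrow> U (g z)"
  shows "U (\<lambda>x. \<phi> x + (\<Sum>z\<in>Z. c z * g z x))"
  using assms(3)
proof (induction Z rule: infinite_finite_induct)
  case (insert z Z)
  then have "U (\<lambda>x. (\<phi> x + (\<Sum>z\<in>Z. c z * g z x)) + c z * g z x)"
    by (intro invariant_family_add_scaled[OF assms(1)]) auto
  then show ?case using insert.hyps by (simp add: add_ac)
qed (use assms in auto)

text \<open>Induction on the roots. With \<open>T\<close> the operator of \<open>a\<close>, the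
  functional \<open>(T - w) \<phi>\<close> is killed by the remaining factors and splits into
  eigenvectors \<open>g z\<close>. Since \<open>z \<noteq> w\<close>, dividing \<open>g z\<close> by
  \<open>z - w\<close> inverts \<open>T - w\<close> on it; subtracting these quotients from
  \<open>\<phi>\<close> leaves an eigenvector for \<open>w\<close>.\<close>

lemma eigen_decomposition:
  assumes U: "invariant_family U" "U \<phi>"
    and Z: "finite Z" "\<And>x. poly_act a \<phi> (\<Prod>z\<in>Z. [:- z, 1:]) x = 0"
  shows "\<exists>g. (\<forall>z\<in>Z. U (g z) \<and> (\<forall>x. g z (a * x) = z * g z x)) \<and> (\<forall>x. \<phi> x = (\<Sum>z\<in>Z. g z x))"
  using Z U(2)
proof (induction Z arbitrary: \<phi> rule: finite_induct)
  case empty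
  then show ?case by (auto simp: poly_act_def)
next
  case (insert w Z)
  define \<psi> where "\<psi> = (\<lambda>x. \<phi> (a * x) - w * \<phi> x)"
  have "U (\<lambda>x. \<phi> (a * x) + (- w) * \<phi> x)"
    by (intro invariant_family_add_scaled[OF U(1)] invariant_family_mult[OF U(1)] insert.prems(2))
  then have "U \<psi>" by (simp add: \<psi>_def)
  moreover have "poly_act a \<psi> (\<Prod>z\<in>Z. [:- z, 1:]) x = 0" for x
    using insert.prems(1)[of x] insert.hyps poly_act_linear_factor[of a \<phi> w] by (simp add: \<psi>_def)
  ultimately have "\<exists>g. (\<forall>z\<in>Z. U (g z) \<and> (\<forall>x. g z (a * x) = z * g z x)) \<and> (\<forall>x. \<psi> x = (\<Sum>z\<in>Z. g z x))"
    by (intro insert.IH)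
  then obtain g where "(\<forall>z\<in>Z. U (g z) \<and> (\<forall>x. g z (a * x) = z * g z x)) \<and> (\<forall>x. \<psi> x = (\<Sum>z\<in>Z. g z x))"
    by (rule exE)
  then have g: "\<And>z. z \<in> Z \<Longrightarrow> U (g z)"
      "\<And>z x. z \<in> Z \<Longrightarrow> g z (a * x) = z * g z x" "\<And>x. \<psi> x = (\<Sum>z\<in>Z. g z x)"
    by simp_all
  define h where "h = (\<lambda>x. \<phi> x + (\<Sum>z\<in>Z. (- 1 / (z - w)) * g z x))"
  have "U h"
    unfolding h_def using U(1) insert.prems(2) g(1) by (rule invariant_family_combination[where g = g and \<phi> = \<phi>])
  have h: "h (a * x) = w * h x" for x
  proof -
    have "(\<Sum>z\<in>Z. (- 1 / (z - w)) * g z (a * x)) - w * (\<Sum>z\<in>Z. (- 1 / (z - w)) * g z x)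
        = (\<Sum>z\<in>Z. (- 1 / (z - w)) * (z - w) * g z x)"
      unfolding sum_distrib_left sum_subtractf[symmetric]
    proof (rule sum.cong[OF refl])
      fix z assume "z \<in> Z"
      have "u * (z * v) - w * (u * v) = u * (z - w) * v" for u v
        by (simp add: algebra_simps)
      then show "- 1 / (z - w) * g z (a * x) - w * (- 1 / (z - w) * g z x) = - 1 / (z - w) * (z - w) * g z x"
        unfolding g(2)[OF \<open>z \<in> Z\<close>] .
    qed
    also have "\<dots> = - (\<Sum>z\<in>Z. g z x)"
      unfolding sum_negf[symmetric] using insert.hyps(2) by (intro sum.cong) auto
    finally show ?thesis
      using g(3)[of x] by (simp add: h_def \<psi>_def algebra_simps)
  qed
  \<comment> \<open>The closure condition offers only \<open>\<phi> + c * \<psi>\<close>, so a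
    multiple is written as \<open>g z\<close> plus a multiple of itself.\<close>
  have scaled: "U (\<lambda>x. (1 / (z - w)) * g z x)" if "z \<in> Z" for z
  proof -
    have "U (\<lambda>x. g z x + (1 / (z - w) - 1) * g z x)"
      using U(1) g(1)[OF that] g(1)[OF that]
      by (rule invariant_family_add_scaled[where \<phi> = "g z" and \<psi> = "g z"])
    then show ?thesis by (simp add: algebra_simps)
  qed
  define g' where "g' = (\<lambda>z. if z = w then h else (\<lambda>x. (1 / (z - w)) * g z x))"
  have "U (g' z) \<and> (\<forall>x. g' z (a * x) = z * g' z x)" if "z \<in> insert w Z" for z
    using that \<open>U h\<close> h scaled g(2) by (auto simp: g'_def)
  moreover have "\<phi> x = (\<Sum>z\<in>insert w Z. g' z x)" for x
  proof -
    have "(\<Sum>z\<in>Z. g' z x) = - (\<Sum>z\<in>Z. (- 1 / (z - w)) * g z x)"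
      unfolding sum_negf[symmetric] using insert.hyps(2) by (intro sum.cong) (auto simp: g'_def)
    then have "(\<Sum>z\<in>insert w Z. g' z x) = h x - (\<Sum>z\<in>Z. (- 1 / (z - w)) * g z x)"
      using insert.hyps by (simp add: g'_def)
    then show ?thesis by (simp add: h_def)
  qed
  ultimately have "(\<forall>z\<in>insert w Z. U (g' z) \<and> (\<forall>x. g' z (a * x) = z * g' z x)) \<and>
      (\<forall>x. \<phi> x = (\<Sum>z\<in>insert w Z. g' z x))"
    by simp
  then show ?case by (rule exI[of _ g'])
qed

text \<open>Because the field is commutative, an eigenspace of \<open>a\<close> inside
  \<open>U\<close> is again an invariant family, and the induction continues there with the
  remaining elements. Closure of \<open>P\<close> under finite sums reassembles the pieces.\<close>

lemma simultaneous_eigen_induct: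
  fixes A :: "'k::number_field set"
  assumes "finite A" "invariant_family U" "U \<phi>"
    and sum: "\<And>g Z. finite (Z :: complex set) \<Longrightarrow> (\<And>z. z \<in> Z \<Longrightarrow> P (g z)) \<Longrightarrow> P (\<lambda>x. \<Sum>z\<in>Z. g z x)"
    and eigen: "\<And>\<psi>. U \<psi> \<Longrightarrow> (\<And>a. a \<in> A \<Longrightarrow> \<exists>z. \<forall>x. \<psi> (a * x) = z * \<psi> x) \<Longrightarrow> P \<psi>"
  shows "P \<phi>"
  using assms(1-3) eigen
proof (induction A arbitrary: U \<phi> rule: finite_induct)
  case empty
  then show ?case by blast
next
  case (insert a A)
  obtain p where p: "poly (map_poly of_rat p) a = 0"
      and sq: "rsquarefree (map_poly of_rat p :: complex poly)"
    using separable_annihilator[of a] by blast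
  define f where "f = (map_poly of_rat p :: complex poly)"
  define Z where "Z = {z. poly f z = 0}"
  have nz: "f \<noteq> 0" using sq by (simp add: f_def rsquarefree_def)
  then have fin: "finite Z" by (simp add: Z_def poly_roots_finite)
  have f: "f = Polynomial.smult (lead_coeff f) (\<Prod>z\<in>Z. [:- z, 1:])"
    using complex_poly_decompose_rsquarefree[OF sq] by (simp add: f_def Z_def)
  have "Modules.additive \<phi>" using insert.prems by (simp add: invariant_family_def)
  from poly_act_annihilator[OF this p] have "poly_act a \<phi> f x = 0" for x
    by (simp add: f_def)
  then have "lead_coeff f * poly_act a \<phi> (\<Prod>z\<in>Z. [:- z, 1:]) x = 0" for x
    by (metis f poly_act_smult)
  then have "poly_act a \<phi> (\<Prod>z\<in>Z. [:- z, 1:]) x = 0" for x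
    using nz by simp
  from eigen_decomposition[OF insert.prems(1,2) fin this]
  obtain g where "(\<forall>z\<in>Z. U (g z) \<and> (\<forall>x. g z (a * x) = z * g z x)) \<and> (\<forall>x. \<phi> x = (\<Sum>z\<in>Z. g z x))"
    by (rule exE)
  then have g: "\<And>z. z \<in> Z \<Longrightarrow> U (g z)" "\<And>z x. z \<in> Z \<Longrightarrow> g z (a * x) = z * g z x"
      "\<And>x. \<phi> x = (\<Sum>z\<in>Z. g z x)"
    by simp_all
  have "P (g z)" if "z \<in> Z" for z
  proof (rule insert.IH[of "\<lambda>\<psi>. U \<psi> \<and> (\<forall>x. \<psi> (a * x) = z * \<psi> x)"])
    show "invariant_family (\<lambda>\<psi>. U \<psi> \<and> (\<forall>x. \<psi> (a * x) = z * \<psi> x))"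
      using insert.prems(1) unfolding invariant_family_def
      by (auto simp: ring_distribs mult.left_commute) (metis mult.left_commute)
    show "U (g z) \<and> (\<forall>x. g z (a * x) = z * g z x)" using g that by blast
    show "P \<psi>" if "U \<psi> \<and> (\<forall>x. \<psi> (a * x) = z * \<psi> x)"
      "\<And>b. b \<in> A \<Longrightarrow> \<exists>w. \<forall>x. \<psi> (b * x) = w * \<psi> x" for \<psi>
      using that by (intro insert.prems(3)) auto
  qed
  then have "P (\<lambda>x. \<Sum>z\<in>Z. g z x)" by (rule sum[OF fin])
  moreover have "\<phi> = (\<lambda>x. \<Sum>z\<in>Z. g z x)" using g(3) by blast
  ultimately show ?case by simp
qed

section \<open>Embeddings as homomorphisms, and the functionals they span\<close>

lemma embeddings_one: "\<sigma> \<in> embeddings \<Longrightarrow> \<sigma> 1 = 1"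
  and embeddings_add: "\<sigma> \<in> embeddings \<Longrightarrow> \<sigma> (x + y) = \<sigma> x + \<sigma> y"
  and embeddings_mult: "\<sigma> \<in> embeddings \<Longrightarrow> \<sigma> (x * y) = \<sigma> x * \<sigma> y"
  by (simp_all add: embeddings_def)

lemma embeddings_additive: "\<sigma> \<in> embeddings \<Longrightarrow> Modules.additive \<sigma>"
  by unfold_locales (rule embeddings_add)

lemma embeddings_of_rat: "\<sigma> \<in> embeddings \<Longrightarrow> \<sigma> (of_rat q) = of_rat q"
  using additive_of_rat[OF embeddings_additive, of \<sigma> q 1] by (simp add: embeddings_one)

lemma embeddings_power: "\<sigma> \<in> embeddings \<Longrightarrow> \<sigma> (x ^ n) = \<sigma> x ^ n"
  by (induction n) (simp_all add: embeddings_one embeddings_mult)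

lemma embeddings_sum: "\<sigma> \<in> embeddings \<Longrightarrow> \<sigma> (sum f A) = (\<Sum>a\<in>A. \<sigma> (f a))"
  using Modules.additive.sum[OF embeddings_additive] by blast

lemma embeddings_diff: "\<sigma> \<in> embeddings \<Longrightarrow> \<sigma> (x - y) = \<sigma> x - \<sigma> y"
  using Modules.additive.diff[OF embeddings_additive] by blast

lemma embeddings_minus: "\<sigma> \<in> embeddings \<Longrightarrow> \<sigma> (- x) = - \<sigma> x"
  using Modules.additive.minus[OF embeddings_additive] by blast

lemma embeddings_zero: "\<sigma> \<in> embeddings \<Longrightarrow> \<sigma> 0 = 0"
  using Modules.additive.zero[OF embeddings_additive] by blast

lemma embeddings_nonzero:
  assumes "\<sigma> \<in> embeddings" "x \<noteq> 0"
  shows "\<sigma> x \<noteq> 0"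
proof
  assume "\<sigma> x = 0"
  then have "\<sigma> (x * inverse x) = 0" using assms(1) by (simp add: embeddings_mult)
  then show False using assms by (simp add: embeddings_one)
qed

lemma embeddings_divide:
  assumes "\<sigma> \<in> embeddings"
  shows "\<sigma> (x / y) = \<sigma> x / \<sigma> y"
proof (cases "y = 0")
  case False
  then have "\<sigma> (x / y) * \<sigma> y = \<sigma> x"
    using assms by (simp flip: embeddings_mult)
  then show ?thesis using embeddings_nonzero[OF assms False] by (simp add: field_simps)
qed (use assms in \<open>simp add: embeddings_zero\<close>)

lemma embeddings_cnj: "\<sigma> \<in> embeddings \<Longrightarrow> cnj \<circ> \<sigma> \<in> embeddings"
  by (simp add: embeddings_def)

lemma embeddings_poly:
  assumes "\<sigma> \<in> embeddings"
  shows "poly (map_poly of_rat p) (\<sigma> a) = \<sigma> (poly (map_poly of_rat p) a)"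
  using assms by (simp add: poly_altdef embeddings_sum embeddings_mult embeddings_of_rat embeddings_power)

lemma embeddings_algebraic_int:
  assumes "\<sigma> \<in> embeddings" "algebraic_int a"
  shows "algebraic_int (\<sigma> a)"
proof -
  obtain p where p: "poly (map_poly of_int p) a = 0" "lead_coeff p = 1"
    using assms(2) unfolding algebraic_int_altdef_ipoly by blast
  have "\<sigma> (of_int n) = of_int n" for n
    using embeddings_of_rat[OF assms(1), of "of_int n"] by simp
  then have "poly (map_poly of_int p) (\<sigma> a) = \<sigma> (poly (map_poly of_int p) a)"
    using assms(1) by (simp add: poly_altdef embeddings_sum embeddings_mult embeddings_power)
  then show ?thesis
    using p assms(1) unfolding algebraic_int_altdef_ipoly by (metis embeddings_zero)
qed

lemma basis_expansion:
  assumes "finite B" "rat_space.independent B" "rat_space.span B = UNIV"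
  shows "x = (\<Sum>b\<in>B. of_rat (rat_space.representation B x b) * b)"
  using rat_space.sum_representation_eq[OF assms(2) _ assms(1), of x] assms(3) by simp

lemma additive_basis_expansion:
  fixes \<phi> :: "'a::field_char_0 \<Rightarrow> 'b::field_char_0"
  assumes "Modules.additive \<phi>"
    and "finite B" "rat_space.independent B" "rat_space.span B = UNIV"
  shows "\<phi> x = (\<Sum>b\<in>B. of_rat (rat_space.representation B x b) * \<phi> b)"
proof -
  have "\<phi> x = \<phi> (\<Sum>b\<in>B. of_rat (rat_space.representation B x b) * b)"
    using basis_expansion[OF assms(2-4), of x] by simp
  then show ?thesis
    by (simp add: Modules.additive.sum[OF assms(1)] additive_of_rat[OF assms(1)])
qed

text \<open>An embedding is determined by its values on a basis, and each value is a root of a fixed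
  nonzero polynomial.\<close>

lemma finite_embeddings: "finite (embeddings :: ('k::number_field \<Rightarrow> complex) set)"
proof -
  obtain B :: "'k set" where B: "finite B" "rat_space.independent B" "rat_space.span B = UNIV"
    using number_field_basis by metis
  have R: "finite ((\<lambda>\<sigma>. \<sigma> b) ` embeddings)" for b :: 'k
  proof -
    obtain p where p: "poly (map_poly of_rat p) b = 0" "rsquarefree (map_poly of_rat p :: complex poly)"
      using separable_annihilator by blast
    have "finite {z :: complex. poly (map_poly of_rat p) z = 0}"
      using p(2) by (intro poly_roots_finite) (simp add: rsquarefree_def)
    moreover have "(\<lambda>\<sigma>. \<sigma> b) ` embeddings \<subseteq> {z. poly (map_poly of_rat p) z = 0}"
      using p(1) by (auto simp: embeddings_poly embeddings_zero)
    ultimately show ?thesis by (rule finite_subset[rotated])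
  qed
  have "inj_on (\<lambda>\<sigma>. restrict \<sigma> B) embeddings"
  proof (rule inj_onI)
    fix \<sigma> \<tau> :: "'k \<Rightarrow> complex"
    assume \<sigma>: "\<sigma> \<in> embeddings" and \<tau>: "\<tau> \<in> embeddings" and eq: "restrict \<sigma> B = restrict \<tau> B"
    have "\<sigma> b = \<tau> b" if "b \<in> B" for b
      using fun_cong[OF eq, of b] that by simp
    then have "(\<Sum>b\<in>B. of_rat (rat_space.representation B x b) * \<sigma> b) =
        (\<Sum>b\<in>B. of_rat (rat_space.representation B x b) * \<tau> b)" for x
      by simp
    then show "\<sigma> = \<tau>"
      unfolding additive_basis_expansion[OF embeddings_additive[OF \<sigma>] B, symmetric]
        additive_basis_expansion[OF embeddings_additive[OF \<tau>] B, symmetric]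
      by (rule ext)
  qed
  moreover have "(\<lambda>\<sigma>. restrict \<sigma> B) ` embeddings \<subseteq> PiE B (\<lambda>b. (\<lambda>\<sigma>. \<sigma> b) ` embeddings)"
    by auto
  ultimately show ?thesis
    using finite_PiE[OF B(1) R] by (meson finite_imageD finite_subset)
qed

text \<open>It suffices to treat a common eigenvector \<open>\<psi>\<close> of a basis. Its
  eigenvalue function \<open>l\<close> satisfies \<open>\<psi> x = l x * \<psi> 1\<close>, so either
  \<open>\<psi>\<close> vanishes or \<open>l\<close> is an embedding.\<close>

lemma additive_combination_of_embeddings:
  fixes \<phi> :: "'k::number_field \<Rightarrow> complex"
  assumes "Modules.additive \<phi>"
  shows "\<exists>c. \<forall>x. \<phi> x = (\<Sum>\<sigma>\<in>embeddings. c \<sigma> * \<sigma> x)"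
proof -
  obtain B :: "'k set" where B: "finite B" "rat_space.independent B" "rat_space.span B = UNIV"
    using number_field_basis by metis
  have "invariant_family (Modules.additive :: ('k \<Rightarrow> complex) \<Rightarrow> bool)"
    unfolding invariant_family_def Modules.additive_def by (auto simp: algebra_simps)
  from B(1) this assms show ?thesis
  proof (rule simultaneous_eigen_induct)
    fix g :: "complex \<Rightarrow> 'k \<Rightarrow> complex" and Z
    assume "finite Z" and "\<And>z. z \<in> Z \<Longrightarrow> \<exists>c. \<forall>x. g z x = (\<Sum>\<sigma>\<in>embeddings. c \<sigma> * \<sigma> x)"
    then obtain c where "\<And>z x. z \<in> Z \<Longrightarrow> g z x = (\<Sum>\<sigma>\<in>embeddings. c z \<sigma> * \<sigma> x)"
      by metis
    then have "(\<Sum>z\<in>Z. g z x) = (\<Sum>\<sigma>\<in>embeddings. (\<Sum>z\<in>Z. c z \<sigma>) * \<sigma> x)" for x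
      by (simp add: sum.swap[of _ Z] sum_distrib_right)
    then show "\<exists>c. \<forall>x. (\<Sum>z\<in>Z. g z x) = (\<Sum>\<sigma>\<in>embeddings. c \<sigma> * \<sigma> x)"
      by (intro exI[of _ "\<lambda>\<sigma>. \<Sum>z\<in>Z. c z \<sigma>"]) simp
  next
    fix \<psi> :: "'k \<Rightarrow> complex"
    assume add: "Modules.additive \<psi>" and "\<And>b. b \<in> B \<Longrightarrow> \<exists>z. \<forall>x. \<psi> (b * x) = z * \<psi> x"
    then obtain z where z: "\<And>b x. b \<in> B \<Longrightarrow> \<psi> (b * x) = z b * \<psi> x" by metis
    \<comment> \<open>Eigenvalues are known on the basis only; this is their linear extension to the
      whole field.\<close>
    define l where "l = (\<lambda>a. \<Sum>b\<in>B. of_rat (rat_space.representation B a b) * z b)"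
    have l: "\<psi> (a * x) = l a * \<psi> x" for a x
    proof -
      have "\<psi> (a * x) = \<psi> (\<Sum>b\<in>B. of_rat (rat_space.representation B a b) * (b * x))"
        by (subst basis_expansion[OF B, of a]) (simp add: sum_distrib_right mult.assoc)
      also have "\<dots> = l a * \<psi> x"
        by (simp add: Modules.additive.sum[OF add] additive_of_rat[OF add] z l_def
            sum_distrib_right mult.assoc)
      finally show ?thesis .
    qed
    have l1: "\<psi> a = l a * \<psi> 1" for a using l[of a 1] by simp
    show "\<exists>c. \<forall>x. \<psi> x = (\<Sum>\<sigma>\<in>embeddings. c \<sigma> * \<sigma> x)"
    proof (cases "\<psi> 1 = 0")
      case True
      then have "\<psi> x = 0" for x using l1[of x] by simp
      then show ?thesis by (intro exI[of _ "\<lambda>_. 0"]) simp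
    next
      case False
      have "l (x * y) = l x * l y" for x y
      proof -
        have "l (x * y) * \<psi> 1 = l x * l y * \<psi> 1"
          using l[of x y] l1[of y] l1[of "x * y"] by (metis mult.assoc)
        then show ?thesis using False by simp
      qed
      moreover have "l (x + y) = l x + l y" for x y
      proof -
        have "l (x + y) * \<psi> 1 = (l x + l y) * \<psi> 1"
          using Modules.additive.add[OF add, of x y] l1 by (metis distrib_right)
        then show ?thesis using False by simp
      qed
      moreover have "l 1 = 1" using l1[of 1] False by (metis mult_cancel_right1)
      ultimately have "l \<in> embeddings" by (simp add: embeddings_def)
      then have "\<psi> x = (\<Sum>\<sigma>\<in>embeddings. (if \<sigma> = l then \<psi> 1 else 0) * \<sigma> x)" for x
        using l1[of x] mult.commute[of "l x" "\<psi> 1"]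
        by (simp add: finite_embeddings if_distribR if_distrib[of "\<lambda>c. c * _"] sum.delta' cong: if_cong)
      then show ?thesis by (intro exI[of _ "\<lambda>\<sigma>. if \<sigma> = l then \<psi> 1 else 0"]) simp
    qed
  qed
qed

section \<open>Independence of embeddings, their number, and the field norm\<close>

text \<open>Dedekind's argument: replacing \<open>x\<close> by \<open>y * x\<close> and subtracting
  \<open>\<tau> y\<close> times the relation removes \<open>\<tau>\<close>. The induction hypothesis
  would make any \<open>\<rho>\<close> with nonzero coefficient equal to
  \<open>\<tau>\<close>.\<close>

lemma embeddings_independent:
  fixes c :: "('k::number_field \<Rightarrow> complex) \<Rightarrow> complex"
  assumes "finite F" "F \<subseteq> embeddings" "\<And>x. (\<Sum>\<sigma>\<in>F. c \<sigma> * \<sigma> x) = 0" "\<sigma> \<in> F"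
  shows "c \<sigma> = 0"
  using assms
proof (induction F arbitrary: c \<sigma> rule: finite_induct)
  case (insert \<tau> F)
  have emb: "\<tau> \<in> embeddings" "F \<subseteq> embeddings" using insert.prems(1) by auto
  have zero: "c \<rho> = 0" if \<rho>: "\<rho> \<in> F" for \<rho>
  proof (rule ccontr)
    assume c: "c \<rho> \<noteq> 0"
    have "c \<rho> * (\<rho> y - \<tau> y) = 0" for y
    proof (rule insert.IH[OF emb(2) _ \<rho>])
      fix x
      have "(\<Sum>\<sigma>\<in>insert \<tau> F. c \<sigma> * \<sigma> (y * x)) - \<tau> y * (\<Sum>\<sigma>\<in>insert \<tau> F. c \<sigma> * \<sigma> x) = 0"
        using insert.prems(2) by simp
      then have "(\<Sum>\<sigma>\<in>insert \<tau> F. c \<sigma> * (\<sigma> y - \<tau> y) * \<sigma> x) = 0"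
        unfolding sum_distrib_left sum_subtractf[symmetric]
        using insert.prems(1) by (subst (asm) sum.cong[OF refl])
          (auto simp: embeddings_mult algebra_simps subset_eq)
      then show "(\<Sum>\<sigma>\<in>F. c \<sigma> * (\<sigma> y - \<tau> y) * \<sigma> x) = 0"
        using insert.hyps by simp
    qed
    then have "\<rho> = \<tau>" using c by (intro ext) simp
    then show False using \<rho> insert.hyps by simp
  qed
  then have "c \<tau> * \<tau> 1 = 0"
    using insert.prems(2)[of 1] insert.hyps by simp
  then have "c \<tau> = 0" using emb(1) by (simp add: embeddings_one)
  with zero insert.prems(3) show ?case by auto
qed simp

text \<open>The coordinate functionals are additive, hence combinations of embeddings. Substituting
  them into the basis expansion of \<open>\<sigma> x\<close> expresses \<open>\<sigma>\<close>
  through all embeddings, and independence forces the trivial coefficients.\<close>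

lemma dual_basis:
  fixes B :: "'k::number_field set"
  assumes B: "finite B" "rat_space.independent B" "rat_space.span B = UNIV"
  obtains c where
    "\<And>b x. of_rat (rat_space.representation B x b) = (\<Sum>\<sigma>\<in>embeddings. c b \<sigma> * \<sigma> x)"
    "\<And>\<sigma> \<tau>. \<sigma> \<in> embeddings \<Longrightarrow> \<tau> \<in> embeddings \<Longrightarrow> (\<Sum>b\<in>B. \<sigma> b * c b \<tau>) = (if \<sigma> = \<tau> then 1 else 0)"
proof -
  have "Modules.additive (\<lambda>x. of_rat (rat_space.representation B x b) :: complex)" for b
    using B by unfold_locales (simp add: rat_space.representation_add of_rat_add)
  then have "\<exists>c. \<forall>x. of_rat (rat_space.representation B x b) = (\<Sum>\<sigma>\<in>embeddings. c \<sigma> * \<sigma> x)" for b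
    by (rule additive_combination_of_embeddings)
  then obtain c where c: "\<And>b x. of_rat (rat_space.representation B x b) = (\<Sum>\<sigma>\<in>embeddings. c b \<sigma> * \<sigma> x)"
    by metis
  have "(\<Sum>b\<in>B. \<sigma> b * c b \<tau>) = (if \<sigma> = \<tau> then 1 else 0)"
    if \<sigma>: "\<sigma> \<in> embeddings" and \<tau>: "\<tau> \<in> embeddings" for \<sigma> \<tau>
  proof -
    define e where "e = (\<lambda>\<tau>. (\<Sum>b\<in>B. \<sigma> b * c b \<tau>) - (if \<sigma> = \<tau> then 1 else 0))"
    have "(\<Sum>\<tau>\<in>embeddings. e \<tau> * \<tau> x) = 0" for x
    proof -
      have "(\<Sum>\<tau>\<in>embeddings. (\<Sum>b\<in>B. \<sigma> b * c b \<tau>) * \<tau> x)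
          = (\<Sum>b\<in>B. \<sigma> b * (\<Sum>\<tau>\<in>embeddings. c b \<tau> * \<tau> x))"
        by (simp add: sum_distrib_left sum_distrib_right sum.swap[of _ B] mult.assoc)
      also have "\<dots> = (\<Sum>b\<in>B. of_rat (rat_space.representation B x b) * \<sigma> b)"
        unfolding c[symmetric] by (rule sum.cong[OF refl mult.commute])
      also have "\<dots> = \<sigma> x"
        by (rule additive_basis_expansion[OF embeddings_additive[OF \<sigma>] B, symmetric])
      finally show ?thesis
        using \<sigma>
        by (simp add: finite_embeddings e_def left_diff_distrib sum_subtractf if_distrib[of "\<lambda>c. c * _"] sum.delta cong: if_cong)
    qed
    then have "e \<tau> = 0"
      using embeddings_independent[OF finite_embeddings subset_refl _ \<tau>] by blast
    then show ?thesis by (simp add: e_def)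
  qed
  with c show ?thesis by (rule that)
qed

text \<open>The two products of the matrices \<open>c b \<sigma>\<close> and \<open>\<sigma> b\<close> are identity matrices; comparing
  their traces gives the number of embeddings.\<close>

lemma card_embeddings:
  "card (embeddings :: ('k::number_field \<Rightarrow> complex) set) = number_field_degree TYPE('k)"
proof -
  obtain B :: "'k set" where B: "finite B" "rat_space.independent B" "rat_space.span B = UNIV"
      "card B = number_field_degree TYPE('k)"
    using number_field_basis by metis
  obtain c where c: "\<And>b x. of_rat (rat_space.representation B x b) = (\<Sum>\<sigma>\<in>embeddings. c b \<sigma> * \<sigma> x)"
    "\<And>\<sigma> \<tau>. \<sigma> \<in> embeddings \<Longrightarrow> \<tau> \<in> embeddings \<Longrightarrow> (\<Sum>b\<in>B. \<sigma> b * c b \<tau>) = (if \<sigma> = \<tau> then 1 else 0)"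
    using dual_basis[OF B(1-3)] by blast
  have "of_nat (card (embeddings :: ('k \<Rightarrow> complex) set)) =
      (\<Sum>\<sigma>\<in>(embeddings :: ('k \<Rightarrow> complex) set). \<Sum>b\<in>B. \<sigma> b * c b \<sigma>)"
    using c(2) by simp
  also have "\<dots> = (\<Sum>b\<in>B. of_rat (rat_space.representation B b b))"
    by (subst sum.swap) (simp add: c(1) mult.commute)
  also have "\<dots> = of_nat (card B)"
    by (simp add: rat_space.representation_basis[OF B(2)])
  finally show ?thesis using B(4) by (simp only: of_nat_eq_iff)
qed

text \<open>\<open>M\<close> is the rational matrix of multiplication by \<open>a\<close>, and
  \<open>M = C * D * E\<close> with \<open>D\<close> diagonal and \<open>E\<close> inverse to
  \<open>C\<close>. The product is therefore \<open>det M\<close>. The matrices are square because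
  embeddings and basis elements are equal in number.\<close>

lemma prod_embeddings_rational:
  fixes a :: "'k::number_field"
  shows "(\<Prod>\<sigma>\<in>embeddings. \<sigma> a) \<in> \<rat>"
proof -
  obtain B :: "'k set" where B: "finite B" "rat_space.independent B" "rat_space.span B = UNIV"
      "card B = number_field_degree TYPE('k)"
    using number_field_basis by metis
  obtain c where c: "\<And>b x. of_rat (rat_space.representation B x b) = (\<Sum>\<sigma>\<in>embeddings. c b \<sigma> * \<sigma> x)"
    "\<And>\<sigma> \<tau>. \<sigma> \<in> embeddings \<Longrightarrow> \<tau> \<in> embeddings \<Longrightarrow> (\<Sum>b\<in>B. \<sigma> b * c b \<tau>) = (if \<sigma> = \<tau> then 1 else 0)"
    using dual_basis[OF B(1-3)] by blast
  define n where "n = card B"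
  obtain f where f: "bij_betw f {0..<n} B"
    using ex_bij_betw_nat_finite[OF B(1)] n_def by blast
  obtain s where s: "bij_betw s {0..<n} (embeddings :: ('k \<Rightarrow> complex) set)"
    using ex_bij_betw_nat_finite[OF finite_embeddings] B(4) card_embeddings[where 'k='k] n_def by metis
  have s_emb: "s i \<in> embeddings" if "i < n" for i
    using s that by (auto simp: bij_betw_def)
  have s_inj: "s i = s j \<longleftrightarrow> i = j" if "i < n" "j < n" for i j
    using s that by (auto simp: bij_betw_def inj_on_def)
  define C where "C = mat n n (\<lambda>(i, j). c (f i) (s j))"
  define E where "E = mat n n (\<lambda>(i, j). s i (f j))"
  define D where "D = mat n n (\<lambda>(i, j). if i = j then s i a else 0)"
  define M where "M = mat n n (\<lambda>(i, j). rat_space.representation B (a * f j) (f i))"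
  have carrier: "C \<in> carrier_mat n n" "E \<in> carrier_mat n n" "D \<in> carrier_mat n n" "M \<in> carrier_mat n n"
    by (simp_all add: C_def E_def D_def M_def)
  have EC: "E * C = 1\<^sub>m n"
  proof (rule eq_matI)
    fix i j assume "i < dim_row (1\<^sub>m n)" "j < dim_col (1\<^sub>m n)"
    then have ij: "i < n" "j < n" by auto
    have "(E * C) $$ (i, j) = (\<Sum>k\<in>{0..<n}. s i (f k) * c (f k) (s j))"
      using ij by (simp add: E_def C_def scalar_prod_def)
    also have "\<dots> = (\<Sum>b\<in>B. s i b * c b (s j))"
      by (rule sum.reindex_bij_betw[OF f])
    also have "\<dots> = 1\<^sub>m n $$ (i, j)"
      using ij c(2)[OF s_emb s_emb] s_inj by simp
    finally show "(E * C) $$ (i, j) = 1\<^sub>m n $$ (i, j)" .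
  qed (simp_all add: E_def C_def)
  have DE: "D * E = mat n n (\<lambda>(i, j). s i a * s i (f j))"
    by (rule eq_matI) (auto simp: D_def E_def scalar_prod_def if_distrib[of "\<lambda>c. c * _"] sum.delta cong: if_cong)
  have "C * (D * E) = map_mat of_rat M"
  proof (rule eq_matI)
    fix i j assume "i < dim_row (map_mat of_rat M :: complex mat)" "j < dim_col (map_mat of_rat M :: complex mat)"
    then have ij: "i < n" "j < n" by (auto simp: M_def)
    have "(C * (D * E)) $$ (i, j) = (\<Sum>k\<in>{0..<n}. c (f i) (s k) * s k (a * f j))"
      using ij s_emb by (simp add: DE C_def scalar_prod_def embeddings_mult)
    also have "\<dots> = (\<Sum>\<sigma>\<in>embeddings. c (f i) \<sigma> * \<sigma> (a * f j))"
      by (rule sum.reindex_bij_betw[OF s])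
    also have "\<dots> = map_mat of_rat M $$ (i, j)"
      using ij by (simp add: M_def c(1))
    finally show "(C * (D * E)) $$ (i, j) = map_mat of_rat M $$ (i, j)" .
  qed (simp_all add: DE C_def M_def)
  then have "det C * (det D * det E) = of_rat (det M)"
    using carrier by (metis det_mult mult_carrier_mat of_rat_hom.hom_det)
  moreover have "det E * det C = 1"
    using carrier EC by (metis det_mult det_one)
  moreover have "det D = (\<Prod>\<sigma>\<in>embeddings. \<sigma> a)"
  proof -
    have "det D = prod_list (diag_mat D)"
      by (rule det_upper_triangular[OF _ carrier(3)]) (auto simp: D_def)
    also have "\<dots> = (\<Prod>i\<in>{0..<n}. s i a)"
      by (simp add: prod_list_diag_prod D_def)
    also have "\<dots> = (\<Prod>\<sigma>\<in>embeddings. \<sigma> a)"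
      by (rule prod.reindex_bij_betw[OF s])
    finally show ?thesis .
  qed
  ultimately have "(\<Prod>\<sigma>\<in>embeddings. \<sigma> a) = of_rat (det M)"
    by (metis mult.assoc mult.commute mult.right_neutral)
  then show ?thesis by simp
qed

text \<open>The product is a rational algebraic integer, so a nonzero ordinary integer.\<close>

lemma prod_embeddings_ge_1:
  fixes a :: "'k::number_field"
  assumes "a \<in> ring_of_integers" "a \<noteq> 0"
  shows "1 \<le> (\<Prod>\<sigma>\<in>(embeddings :: ('k \<Rightarrow> complex) set). cmod (\<sigma> a))"
proof -
  let ?N = "\<Prod>\<sigma>\<in>(embeddings :: ('k \<Rightarrow> complex) set). \<sigma> a"
  have "algebraic_int ?N"
    using assms(1) by (intro algebraic_int_prod embeddings_algebraic_int) (auto simp: ring_of_integers_def)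
  then have "?N \<in> \<int>"
    using prod_embeddings_rational[of a] by (rule rational_algebraic_int_is_int)
  then obtain m where m: "?N = of_int m" by (auto elim: Ints_cases)
  have "?N \<noteq> 0"
    using embeddings_nonzero[OF _ assms(2)] by (simp add: finite_embeddings)
  then have "1 \<le> cmod ?N" unfolding m by simp
  then show ?thesis by (simp add: prod_norm)
qed


section \<open>Places and the space \<open>K\<^sub>S\<close>\<close>

lemma embeddings_nonempty: "(embeddings :: ('k::number_field \<Rightarrow> complex) set) \<noteq> {}"
proof
  assume "(embeddings :: ('k \<Rightarrow> complex) set) = {}"
  then have "number_field_degree TYPE('k) = 0"
    using card_embeddings[where 'k='k] by simp
  then obtain B :: "'k set" where "B = {}" "rat_space.span B = UNIV"
    using number_field_basis[where 'k='k] by (metis card_0_eq)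
  then have "(1 :: 'k) \<in> {0}" by (metis UNIV_I rat_space.span_empty)
  then show False by simp
qed

lemma finite_arch_places: "finite (arch_places :: 'k::number_field place set)"
  unfolding arch_places_def by (intro finite_imageI finite_embeddings)

lemma arch_places_nonempty: "(arch_places :: 'k::number_field place set) \<noteq> {}"
  unfolding arch_places_def using embeddings_nonempty by blast

lemma cnj_comp_cnj_comp: "cnj \<circ> (cnj \<circ> \<sigma>) = \<sigma>"
  by (simp add: fun_eq_iff)

lemma arch_place_eq:
  assumes "v \<in> arch_places" "\<sigma> \<in> v"
  shows "\<sigma> \<in> embeddings" "v = {\<sigma>, cnj \<circ> \<sigma>}"
proof -
  obtain \<tau> where \<tau>: "\<tau> \<in> embeddings" "v = {\<tau>, cnj \<circ> \<tau>}"
    using assms(1) unfolding arch_places_def by blast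
  then have "\<sigma> = \<tau> \<or> \<sigma> = cnj \<circ> \<tau>" using assms(2) by simp
  then show "\<sigma> \<in> embeddings" "v = {\<sigma>, cnj \<circ> \<sigma>}"
    using \<tau> embeddings_cnj[OF \<tau>(1)] cnj_comp_cnj_comp[of \<tau>] by auto
qed

lemma place_embedding_in: "v \<in> arch_places \<Longrightarrow> place_embedding v \<in> v"
  unfolding place_embedding_def some_in_eq arch_places_def by auto

lemma place_embedding_embeddings: "v \<in> arch_places \<Longrightarrow> place_embedding v \<in> embeddings"
  using arch_place_eq(1) place_embedding_in by blast

lemma cmod_place_embedding:
  assumes "v \<in> arch_places" "\<sigma> \<in> v"
  shows "cmod (place_embedding v a) = cmod (\<sigma> a)"
  using place_embedding_in[OF assms(1)] arch_place_eq(2)[OF assms] by auto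

lemma Union_arch_places: "\<Union>arch_places = embeddings"
proof
  show "\<Union>arch_places \<subseteq> embeddings" using arch_place_eq(1) by blast
  show "embeddings \<subseteq> \<Union>arch_places" unfolding arch_places_def by blast
qed

lemma arch_places_disjoint:
  assumes "v \<in> arch_places" "w \<in> arch_places" "v \<noteq> w"
  shows "v \<inter> w = {}"
proof (rule ccontr)
  assume "v \<inter> w \<noteq> {}"
  then obtain \<sigma> where "\<sigma> \<in> v" "\<sigma> \<in> w" by blast
  then have "v = {\<sigma>, cnj \<circ> \<sigma>}" "w = {\<sigma>, cnj \<circ> \<sigma>}"
    using arch_place_eq(2) assms(1,2) by blast+
  then show False using assms(3) by simp
qed

lemma arch_place_finite: "v \<in> arch_places \<Longrightarrow> finite v"
  unfolding arch_places_def by auto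

text \<open>A place is the set of its embeddings, so \<open>card v\<close> is its local degree; the
  places partition the embeddings.\<close>

lemma sum_card_arch_places:
  "(\<Sum>v\<in>(arch_places :: 'k::number_field place set). card v) = number_field_degree TYPE('k)"
proof -
  have "card (\<Union>(arch_places :: 'k place set)) = (\<Sum>v\<in>(arch_places :: 'k place set). card v)"
  proof (rule card_Union_disjoint)
    show "pairwise disjnt (arch_places :: 'k place set)"
      using arch_places_disjoint by (auto simp: pairwise_def disjnt_def)
  qed (rule arch_place_finite)
  then show ?thesis by (simp add: Union_arch_places card_embeddings)
qed

lemma prod_embeddings_arch_places:
  fixes a :: "'k::number_field"
  shows "(\<Prod>\<sigma>\<in>embeddings. cmod (\<sigma> a)) = (\<Prod>v\<in>arch_places. cmod (place_embedding v a) ^ card v)"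
proof -
  have "(\<Prod>\<sigma>\<in>\<Union>arch_places. cmod (\<sigma> a)) = (\<Prod>v\<in>arch_places. \<Prod>\<sigma>\<in>v. cmod (\<sigma> a))"
    using arch_place_finite arch_places_disjoint by (subst prod.Union_disjoint) auto
  also have "\<dots> = (\<Prod>v\<in>arch_places. cmod (place_embedding v a) ^ card v)"
  proof (rule prod.cong[OF refl])
    fix v :: "'k place" assume v: "v \<in> arch_places"
    have "(\<Prod>\<sigma>\<in>v. cmod (\<sigma> a)) = (\<Prod>\<sigma>\<in>v. cmod (place_embedding v a))"
      by (rule prod.cong[OF refl]) (rule cmod_place_embedding[OF v, symmetric])
    then show "(\<Prod>\<sigma>\<in>v. cmod (\<sigma> a)) = cmod (place_embedding v a) ^ card v" by simp
  qed
  finally show ?thesis by (simp only: Union_arch_places)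
qed

text \<open>A complex place counts once here. If all places have local degree \<open>k\<close>, the
  absolute field norm is the \<open>k\<close>-th power of this product.\<close>

definition place_norm :: "'k::number_field \<Rightarrow> real" where
  "place_norm a = (\<Prod>v\<in>arch_places. cmod (place_embedding v a))"

lemma real_embedding_iff: "real_embedding \<sigma> \<longleftrightarrow> cnj \<circ> \<sigma> = \<sigma>"
  unfolding real_embedding_def by (auto simp: fun_eq_iff Reals_cnj_iff image_subset_iff)

text \<open>If some embedding is real, then \<open>d \<le> 2\<close>, and a conjugate pair beside it
  would give three embeddings. So real and complex places never occur together.\<close>

lemma place_degree_constant:
  assumes d: "number_field_degree TYPE('k::number_field) = d"
    and cases: "d = 1 \<or> d = 2 \<or> (d = 4 \<and> totally_complex TYPE('k))"
  obtains k where "k = 1 \<or> k = 2" "\<And>v. v \<in> (arch_places :: 'k place set) \<Longrightarrow> card v = k"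
    "k * card (arch_places :: 'k place set) = d" "d = 4 \<Longrightarrow> k = 2"
proof -
  let ?S = "arch_places :: 'k place set"
  have "\<exists>k. (k = 1 \<or> k = 2) \<and> (\<forall>v\<in>?S. card v = k) \<and> (d = 4 \<longrightarrow> k = 2)"
  proof (cases "totally_complex TYPE('k)")
    case True
    have "card v = 2" if v: "v \<in> ?S" for v
    proof -
      have "cnj \<circ> place_embedding v \<noteq> place_embedding v"
        using True place_embedding_embeddings[OF v]
        unfolding totally_complex_def real_embedding_iff by blast
      then have "card {place_embedding v, cnj \<circ> place_embedding v} = 2"
        by (simp add: card_2_iff)
      then show ?thesis using arch_place_eq(2)[OF v place_embedding_in[OF v]] by simp
    qed
    then show ?thesis by blast
  next
    case False
    then obtain \<sigma> :: "'k \<Rightarrow> complex" where \<sigma>: "\<sigma> \<in> embeddings" "cnj \<circ> \<sigma> = \<sigma>"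
      unfolding totally_complex_def real_embedding_iff by blast
    have "card v = 1" if v: "v \<in> ?S" for v
    proof -
      define \<tau> where "\<tau> = place_embedding v"
      have \<tau>: "\<tau> \<in> embeddings" "v = {\<tau>, cnj \<circ> \<tau>}"
        using place_embedding_embeddings[OF v] arch_place_eq(2)[OF v place_embedding_in[OF v]]
        by (auto simp: \<tau>_def)
      have "cnj \<circ> \<tau> = \<tau>"
      proof (rule ccontr)
        assume ne: "cnj \<circ> \<tau> \<noteq> \<tau>"
        then have "\<sigma> \<noteq> \<tau>" "\<sigma> \<noteq> cnj \<circ> \<tau>"
          using \<sigma>(2) cnj_comp_cnj_comp[of \<tau>] by metis+
        then have "card {\<sigma>, \<tau>, cnj \<circ> \<tau>} = 3" using ne by auto
        moreover have "card {\<sigma>, \<tau>, cnj \<circ> \<tau>} \<le> card (embeddings :: ('k \<Rightarrow> complex) set)"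
          using \<sigma>(1) \<tau>(1) embeddings_cnj by (intro card_mono finite_embeddings) auto
        ultimately show False using cases False d card_embeddings[where 'k='k] by auto
      qed
      then show ?thesis using \<tau>(2) by simp
    qed
    then show ?thesis using cases False by auto
  qed
  then obtain k where k: "k = 1 \<or> k = 2" "\<And>v. v \<in> ?S \<Longrightarrow> card v = k" "d = 4 \<Longrightarrow> k = 2"
    by blast
  moreover have "k * card ?S = d"
    using sum_card_arch_places[where 'k='k] k(2) d by (simp add: mult.commute)
  ultimately show ?thesis by (intro that[of k])
qed

lemma card_arch_places:
  assumes "number_field_degree TYPE('k::number_field) = d"
    and "d = 1 \<or> d = 2 \<or> (d = 4 \<and> totally_complex TYPE('k))"
  shows "card (arch_places :: 'k place set) = 1 \<or> card (arch_places :: 'k place set) = 2"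
proof -
  obtain k where "k = 1 \<or> k = 2" "k * card (arch_places :: 'k place set) = d" "d = 4 \<Longrightarrow> k = 2"
    using place_degree_constant[OF assms] by blast
  then show ?thesis using assms(2) by auto
qed

lemma place_norm_ge_1:
  fixes a :: "'k::number_field"
  assumes "number_field_degree TYPE('k) = d"
    and "d = 1 \<or> d = 2 \<or> (d = 4 \<and> totally_complex TYPE('k))"
    and a: "a \<in> ring_of_integers" "a \<noteq> 0"
  shows "1 \<le> place_norm a"
proof -
  obtain k where k: "k = 1 \<or> k = 2" "\<And>v. v \<in> (arch_places :: 'k place set) \<Longrightarrow> card v = k"
    using place_degree_constant[OF assms(1,2)] by metis
  have "1 \<le> place_norm a ^ k"
    using prod_embeddings_ge_1[OF a] k(2)
    by (simp add: prod_embeddings_arch_places place_norm_def prod_power_distrib)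
  moreover have "0 \<le> place_norm a"
    by (simp add: place_norm_def prod_nonneg)
  ultimately show ?thesis
    using k(1) power2_le_imp_le[of 1 "place_norm a"] by auto
qed

section \<open>The maximum norm and the complete metric space\<close>

lemma cmod_le_KS_norm: "v \<in> arch_places \<Longrightarrow> cmod (x v) \<le> KS_norm x"
  unfolding KS_norm_def by (simp add: finite_arch_places)

lemma KS_norm_attained:
  obtains v where "v \<in> arch_places" "KS_norm x = cmod (x v)"
proof -
  have "KS_norm x \<in> (\<lambda>v. cmod (x v)) ` arch_places"
    unfolding KS_norm_def by (intro Max_in) (simp_all add: finite_arch_places arch_places_nonempty)
  then show ?thesis using that by blast
qed

lemma cmod_le_KS_dist: "v \<in> arch_places \<Longrightarrow> cmod (x v - y v) \<le> KS_dist x y"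
  unfolding KS_dist_def using cmod_le_KS_norm[of v "\<lambda>v\<in>arch_places. x v - y v"] by simp

lemma KS_dist_attained:
  obtains v where "v \<in> arch_places" "KS_dist x y = cmod (x v - y v)"
proof -
  obtain v where "v \<in> arch_places" "KS_dist x y = cmod ((\<lambda>v\<in>arch_places. x v - y v) v)"
    unfolding KS_dist_def by (rule KS_norm_attained)
  then show ?thesis by (intro that[of v]) simp_all
qed

lemma real_in_place_completion: "of_real t \<in> place_completion v"
  by (simp add: place_completion_def)

lemma place_completion_add:
  "x \<in> place_completion v \<Longrightarrow> y \<in> place_completion v \<Longrightarrow> x + y \<in> place_completion v"
  by (simp add: place_completion_def split: if_splits)

lemma closed_place_completion: "closed (place_completion v)"
  by (simp add: place_completion_def closed_complex_Reals)

lemma KS_embed_in_KS: "KS_embed r \<in> KS"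
  unfolding KS_embed_def KS_def place_completion_def real_embedding_def by (auto simp: image_subset_iff)

interpretation KS_metric: Metric_space "KS :: ('k::number_field place \<Rightarrow> complex) set" KS_dist
proof
  fix x y z :: "'k place \<Rightarrow> complex"
  obtain v where v: "v \<in> arch_places" "KS_dist x y = cmod (x v - y v)"
    by (rule KS_dist_attained)
  show "0 \<le> KS_dist x y" using v by simp
  have "KS_dist x y \<le> KS_dist y x" for x y :: "'k place \<Rightarrow> complex"
  proof -
    obtain v where v: "v \<in> arch_places" "KS_dist x y = cmod (x v - y v)"
      by (rule KS_dist_attained)
    then show ?thesis using cmod_le_KS_dist[OF v(1), of y x] by (simp add: norm_minus_commute)
  qed
  then show "KS_dist x y = KS_dist y x" by (simp add: antisym)
  show "KS_dist x z \<le> KS_dist x y + KS_dist y z"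
  proof -
    obtain v where v: "v \<in> arch_places" "KS_dist x z = cmod (x v - z v)"
      by (rule KS_dist_attained)
    have "cmod (x v - z v) \<le> cmod (x v - y v) + cmod (y v - z v)"
      using norm_triangle_ineq[of "x v - y v" "y v - z v"] by simp
    then show ?thesis using v cmod_le_KS_dist[OF v(1), of x y] cmod_le_KS_dist[OF v(1), of y z] by simp
  qed
  assume xy: "x \<in> KS" "y \<in> KS"
  show "KS_dist x y = 0 \<longleftrightarrow> x = y"
  proof
    assume "KS_dist x y = 0"
    then have "x w = y w" if "w \<in> arch_places" for w
      using cmod_le_KS_dist[OF that, of x y] by simp
    then show "x = y" using xy unfolding KS_def by (intro PiE_ext) auto
  qed (use v in simp)
qed

lemma KS_mcomplete: "Metric_space.mcomplete (KS :: ('k::number_field place \<Rightarrow> complex) set) KS_dist"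
  unfolding KS_metric.mcomplete_def
proof (intro allI impI)
  fix f :: "nat \<Rightarrow> 'k place \<Rightarrow> complex"
  assume Cauchy: "KS_metric.MCauchy f"
  then have fKS: "f n \<in> KS" for n
    unfolding KS_metric.MCauchy_def by blast
  have "\<exists>l. (\<lambda>n. f n v) \<longlonglongrightarrow> l" if v: "v \<in> arch_places" for v
  proof -
    have "Cauchy (\<lambda>n. f n v)"
    proof (rule CauchyI)
      fix e :: real assume "0 < e"
      then obtain N where "\<And>m n. N \<le> m \<Longrightarrow> N \<le> n \<Longrightarrow> KS_dist (f m) (f n) < e"
        using Cauchy unfolding KS_metric.MCauchy_def by meson
      then show "\<exists>N. \<forall>m\<ge>N. \<forall>n\<ge>N. cmod (f m v - f n v) < e"
        using cmod_le_KS_dist[OF v] by (meson order_le_less_trans)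
    qed
    then show ?thesis by (simp add: Cauchy_convergent_iff convergent_def)
  qed
  then obtain l where l: "\<And>v. v \<in> arch_places \<Longrightarrow> (\<lambda>n. f n v) \<longlonglongrightarrow> l v" by metis
  define x where "x = (\<lambda>v\<in>arch_places. l v)"
  have "l v \<in> place_completion v" if v: "v \<in> arch_places" for v
    using closed_place_completion
  proof (rule closed_sequentially)
    show "f n v \<in> place_completion v" for n
      using fKS[of n] v unfolding KS_def by auto
  qed (rule l[OF v])
  then have "x \<in> KS" unfolding x_def KS_def by simp
  moreover have "\<forall>\<^sub>F n in sequentially. f n \<in> KS \<and> KS_dist (f n) x < e" if "0 < e" for e
  proof -
    have "\<forall>v\<in>arch_places. \<forall>\<^sub>F n in sequentially. dist (f n v) (l v) < e"
      using tendstoD[OF l that] by blast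
    then have "\<forall>\<^sub>F n in sequentially. \<forall>v\<in>arch_places. dist (f n v) (l v) < e"
      by (rule eventually_ball_finite[OF finite_arch_places])
    then show ?thesis
    proof (rule eventually_mono)
      fix n assume less: "\<forall>v\<in>arch_places. dist (f n v) (l v) < e"
      obtain v where v: "v \<in> arch_places" "KS_dist (f n) x = cmod (f n v - x v)"
        by (rule KS_dist_attained)
      then show "f n \<in> KS \<and> KS_dist (f n) x < e"
        using fKS[of n] less by (simp add: x_def dist_norm)
    qed
  qed
  ultimately show "\<exists>x. limitin KS_metric.mtopology f x sequentially"
    unfolding KS_metric.limitin_metric by blast
qed

lemma KS_unbounded_spheres:
  fixes c :: "'k::number_field place \<Rightarrow> complex"
  assumes "c \<in> KS" "0 < t"
  shows "\<exists>y\<in>KS. KS_dist c y = t"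
proof
  \<comment> \<open>A real shift stays inside real and complex completions alike and moves every
    coordinate by exactly \<open>t\<close>.\<close>
  let ?y = "\<lambda>v\<in>arch_places. c v + of_real t"
  show "?y \<in> KS"
    using assms(1) unfolding KS_def by (auto intro!: place_completion_add real_in_place_completion)
  obtain v where "v \<in> arch_places" "KS_dist c ?y = cmod (c v - ?y v)"
    by (rule KS_dist_attained)
  then show "KS_dist c ?y = t" using assms(2) by simp
qed

section \<open>Heights and separation of fractions\<close>

text \<open>The exponent is \<open>2 / card arch_places\<close>; the truncating division is exact because there are
  at most two places.\<close>

definition height :: "'k::number_field \<Rightarrow> real" where
  "height q = place_norm q ^ (2 div card (arch_places :: 'k place set))"

lemma cmod_place_embedding_le:
  "v \<in> arch_places \<Longrightarrow> cmod (place_embedding v q) \<le> KS_norm (KS_embed q)"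
  using cmod_le_KS_norm[of v "KS_embed q"] by (simp add: KS_embed_def)

text \<open>With one place the height is the square of \<open>|q|\<close> at \<open>v\<close>; with
  two it is the product of both absolute values, and the one away from \<open>v\<close> is at most
  the norm. Thus \<open>v\<close> may even be the place where \<open>q\<close> is smallest.\<close>

lemma height_le:
  fixes q :: "'k::number_field" and v :: "'k place"
  assumes card: "card (arch_places :: 'k place set) = 1 \<or> card (arch_places :: 'k place set) = 2"
    and v: "v \<in> arch_places"
  shows "height q \<le> cmod (place_embedding v q) * KS_norm (KS_embed q)"
proof -
  note le = cmod_place_embedding_le[of _ q]
  from card show ?thesis
  proof
    assume 1: "card (arch_places :: 'k place set) = 1"
    then obtain u where u: "(arch_places :: 'k place set) = {u}" by (rule card_1_singletonE)
    then have "v \<in> {u}" using v by metis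
    then have eq: "(arch_places :: 'k place set) = {v}" using u by blast
    have "height q = cmod (place_embedding v q) * cmod (place_embedding v q)"
      unfolding height_def place_norm_def eq by (simp add: power2_eq_square)
    then show ?thesis using le[OF v] by (simp add: mult_left_mono)
  next
    assume 2: "card (arch_places :: 'k place set) = 2"
    have "card ((arch_places :: 'k place set) - {v}) = 1"
      using 2 v by (simp add: finite_arch_places)
    then obtain w where w': "(arch_places :: 'k place set) - {v} = {w}" by (rule card_1_singletonE)
    have w: "(arch_places :: 'k place set) = {v, w}" "w \<noteq> v"
      using insert_Diff[OF v] singletonI[of w] unfolding w'[symmetric] by simp_all
    have "height q = cmod (place_embedding v q) * cmod (place_embedding w q)"
      unfolding height_def place_norm_def w(1) using w(2) by (simp flip: numeral_2_eq_2)
    moreover have "w \<in> arch_places" unfolding w(1) by simp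
    ultimately show ?thesis using le[of w] by (simp add: mult_left_mono)
  qed
qed

lemma place_norm_le_KS_dist:
  fixes a b :: "'k::number_field"
  shows "place_norm (a - b) \<le> KS_dist (KS_embed a) (KS_embed b) ^ card (arch_places :: 'k place set)"
proof -
  have "place_norm (a - b) \<le> (\<Prod>v\<in>(arch_places :: 'k place set). KS_dist (KS_embed a) (KS_embed b))"
    unfolding place_norm_def
  proof (intro prod_mono conjI)
    fix v :: "'k place" assume v: "v \<in> arch_places"
    show "cmod (place_embedding v (a - b)) \<le> KS_dist (KS_embed a) (KS_embed b)"
      using cmod_le_KS_dist[OF v, of "KS_embed a" "KS_embed b"] v
      by (simp add: KS_embed_def embeddings_diff[OF place_embedding_embeddings])
  qed simp
  then show ?thesis by simp
qed

lemma place_norm_mult: "place_norm (a * b) = place_norm a * place_norm b"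
  by (simp add: place_norm_def embeddings_mult[OF place_embedding_embeddings] norm_mult prod.distrib)

lemma KS_embed_separated:
  fixes p q p' q' :: "'k::number_field"
  assumes K: "number_field_degree TYPE('k) = d" "d = 1 \<or> d = 2 \<or> (d = 4 \<and> totally_complex TYPE('k))"
    and int: "p \<in> ring_of_integers" "q \<in> ring_of_integers - {0}"
      "p' \<in> ring_of_integers" "q' \<in> ring_of_integers - {0}"
    and neq: "p / q \<noteq> p' / q'"
  shows "1 \<le> (KS_dist (KS_embed (p / q)) (KS_embed (p' / q')))\<^sup>2 * (height q * height q')"
proof -
  let ?s = "card (arch_places :: 'k place set)"
  let ?D = "KS_dist (KS_embed (p / q)) (KS_embed (p' / q'))"
  have s: "?s = 1 \<or> ?s = 2" by (rule card_arch_places[OF K])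
  define a where "a = p * q' - p' * q"
  have a: "a = (p / q - p' / q') * (q * q')" using int by (simp add: a_def field_simps)
  have "a \<in> ring_of_integers"
    using int by (auto simp: a_def ring_of_integers_def intro: algebraic_int_diff algebraic_int_times)
  moreover have "a \<noteq> 0" using neq int unfolding a by simp
  ultimately have "1 \<le> place_norm a" by (rule place_norm_ge_1[OF K])
  also have "\<dots> = place_norm (p / q - p' / q') * (place_norm q * place_norm q')"
    unfolding a by (simp only: place_norm_mult)
  also have "\<dots> \<le> ?D ^ ?s * (place_norm q * place_norm q')"
    by (intro mult_right_mono place_norm_le_KS_dist) (simp add: place_norm_def prod_nonneg)
  \<comment> \<open>Since \<open>?s\<close> divides 2, this power turns \<open>?D ^ ?s\<close> into
    the square and each \<open>place_norm\<close> into a \<open>height\<close>.\<close>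
  finally have "1 \<le> (?D ^ ?s * (place_norm q * place_norm q')) ^ (2 div ?s)"
    by (rule one_le_power)
  also have "\<dots> = ?D\<^sup>2 * (height q * height q')"
    using s by (auto simp: height_def power_mult_distrib)
  finally show ?thesis .
qed

lemma badly_approximable_if_far:
  fixes x :: "'k::number_field place \<Rightarrow> complex"
  assumes K: "number_field_degree TYPE('k) = d" "d = 1 \<or> d = 2 \<or> (d = 4 \<and> totally_complex TYPE('k))"
    and \<gamma>: "0 < \<gamma>"
    and far: "\<And>p q. p \<in> ring_of_integers \<Longrightarrow> q \<in> ring_of_integers - {0} \<Longrightarrow>
      \<gamma> / height q < KS_dist x (KS_embed (p / q))"
  shows "badly_approximable x"
  unfolding badly_approximable_def
proof (intro exI[of _ \<gamma>] conjI ballI)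
  fix p q :: 'k assume p: "p \<in> ring_of_integers" and q: "q \<in> ring_of_integers - {0}"
  \<comment> \<open>Bad approximability is stated for \<open>q * x + p\<close>, so the fraction to
    be avoided is \<open>- p / q\<close>.\<close>
  have "- p \<in> ring_of_integers" using p by (simp add: ring_of_integers_def)
  then have "\<gamma> / height q < KS_dist x (KS_embed (- p / q))" using q by (rule far)
  \<comment> \<open>The whole estimate takes place at one \<open>v\<close> realising the distance.
    This place cannot be prescribed, which is why \<open>height_le\<close> is available for all of
    them.\<close>
  moreover obtain v where v: "v \<in> arch_places"
    "KS_dist x (KS_embed (- p / q)) = cmod (x v - KS_embed (- p / q) v)"
    by (rule KS_dist_attained)
  ultimately have less: "\<gamma> / height q < cmod (x v - KS_embed (- p / q) v)" by simp
  note \<sigma> = place_embedding_embeddings[OF v(1)]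
  let ?qv = "place_embedding v q"
  have qv: "?qv \<noteq> 0" using embeddings_nonzero[OF \<sigma>] q by simp
  have "1 \<le> place_norm q" using place_norm_ge_1[OF K] q by simp
  then have "1 \<le> height q" unfolding height_def by (rule one_le_power)
  moreover have "height q \<le> cmod ?qv * KS_norm (KS_embed q)"
    by (rule height_le[OF card_arch_places[OF K] v(1)])
  moreover have "0 < KS_norm (KS_embed q)"
    using qv by (intro less_le_trans[OF _ cmod_place_embedding_le[OF v(1), of q]]) simp
  ultimately have "\<gamma> * inverse (KS_norm (KS_embed q)) \<le> cmod ?qv * (\<gamma> / height q)"
    using \<gamma> by (simp add: field_simps)
  also have "\<dots> < cmod ?qv * cmod (x v - KS_embed (- p / q) v)"
    using less qv by (intro mult_strict_left_mono) auto
  also have "\<dots> = cmod (KS_embed q v * x v + KS_embed p v)"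
    using v(1) qv unfolding norm_mult[symmetric]
    by (simp add: KS_embed_def embeddings_divide[OF \<sigma>] embeddings_minus[OF \<sigma>] algebra_simps)
  also have "\<dots> \<le> KS_norm (\<lambda>v\<in>arch_places. KS_embed q v * x v + KS_embed p v)"
    using cmod_le_KS_norm[OF v(1), of "\<lambda>v\<in>arch_places. KS_embed q v * x v + KS_embed p v"] v(1) by simp
  finally show "\<gamma> * inverse (KS_norm (KS_embed q)) < KS_norm (\<lambda>v\<in>arch_places. KS_embed q v * x v + KS_embed p v)" .
qed (fact \<gamma>)

theorem corollary1p5:
  fixes d :: nat
  assumes "number_field_degree TYPE('k::number_field) = d"
    and "d = 1 \<or> d = 2 \<or> (d = 4 \<and> totally_complex TYPE('k))"
  shows "absolute_winning (KS :: ('k place \<Rightarrow> complex) set) KS_dist BA"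
proof -
  \<comment> \<open>Every representation of a fraction enters with its own height, so the final
    bound applies to any pair \<open>p\<close>, \<open>q\<close> without reduction to lowest
    terms.\<close>
  define Q :: "(('k place \<Rightarrow> complex) \<times> real) set" where
    "Q = {(KS_embed (p / q), height q) | p q. p \<in> ring_of_integers \<and> q \<in> ring_of_integers - {0}}"
  interpret separated_points "KS :: ('k place \<Rightarrow> complex) set" KS_dist Q
  proof unfold_locales
    show "Metric_space.mcomplete (KS :: ('k place \<Rightarrow> complex) set) KS_dist" by (rule KS_mcomplete)
    show "\<exists>y\<in>KS. KS_dist c y = t" if "c \<in> KS" "0 < t" for c :: "'k place \<Rightarrow> complex" and t
      using that by (rule KS_unbounded_spheres)
    show "r \<in> KS" if "(r, h) \<in> Q" for r h
      using that by (auto simp: Q_def KS_embed_in_KS)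
    show "1 \<le> h" if "(r, h) \<in> Q" for r h
      using that place_norm_ge_1[OF assms] by (auto simp: Q_def height_def one_le_power)
    show "1 \<le> (KS_dist r r')\<^sup>2 * (h * h')" if rs: "(r, h) \<in> Q" "(r', h') \<in> Q" "r \<noteq> r'" for r h r' h'
    proof -
      obtain p q where pq: "r = KS_embed (p / q)" "h = height q" "p \<in> ring_of_integers" "q \<in> ring_of_integers - {0}"
        using rs(1) unfolding Q_def by blast
      obtain p' q' where pq': "r' = KS_embed (p' / q')" "h' = height q'" "p' \<in> ring_of_integers" "q' \<in> ring_of_integers - {0}"
        using rs(2) unfolding Q_def by blast
      have "p / q \<noteq> p' / q'" using rs(3) pq(1) pq'(1) by auto
      from KS_embed_separated[OF assms pq(3,4) pq'(3,4) this] show ?thesis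
        by (simp only: pq(1,2) pq'(1,2))
    qed
  qed
  show ?thesis
  proof (rule absolute_winning_avoiding)
    show "BA \<subseteq> (KS :: ('k place \<Rightarrow> complex) set)" by (auto simp: BA_def)
    show "x \<in> BA" if x: "x \<in> KS" "0 < \<gamma>" and far: "\<And>r h. (r, h) \<in> Q \<Longrightarrow> \<gamma> / h < KS_dist x r"
      for x :: "'k place \<Rightarrow> complex" and \<gamma>
      unfolding BA_def
    proof (intro CollectI conjI)
      show "badly_approximable x"
      proof (rule badly_approximable_if_far[OF assms x(2)])
        fix p q :: 'k assume "p \<in> ring_of_integers" "q \<in> ring_of_integers - {0}"
        then have "(KS_embed (p / q), height q) \<in> Q" unfolding Q_def by blast
        then show "\<gamma> / height q < KS_dist x (KS_embed (p / q))" by (rule far)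
      qed
    qed (fact x(1))
  qed
qed

end
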